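(* Let $f \in \mathbb{Q}[X]$ and suppose $f = q\cdot F_1^{\beta_1}\cdots F_m^{\beta_m}$ with $m\geq 0$, positive integers $\beta_1,\ldots,\beta_m$, pairwise distinct monic irreducible polynomials $F_1,\ldots,F_m\in\mathbb{Q}[X]$, and $q\in\mathbb{Q}^\times$. Then $Z_f = Z_{F_1}^{\beta_1}\cdots Z_{F_m}^{\beta_m}$ (product of cosets in $\mathcal{M}(U)^\times/\mathcal{E}(U)$).
   Context: Let $U := \{s\in\mathbb{C}\mid \mathrm{Re}(s)>1\}$, $\mathcal{M}(U)^\times$ the multiplicative group of nonzero meromorphic functions on $U$, and $\mathcal{E}(U)\subseteq\mathcal{M}(U)^\times$ the subgroup generated by the functions $s\mapsto 1-a^{-s}$ for integers $a\geq 2$. For a prime $p$, let $\mathbb{Z}_{(p)}$ be the localization of $\mathbb{Z}$ at $p\mathbb{Z}$. For $f \in \mathbb{Q}[X]$ let $\mathcal{P}_f$ be the set of primes $p$ with $f \in \mathbb{Z}_{(p)}[X]$; for such $p$ let $\overline{f}$ be the reduction modulo $p$; if $\overline{f}\neq 0$ write $\overline{f} = \overline{u}\,\overline{f_1}^{\alpha_1}\cdots \overline{f_k}^{\alpha_k}$ with $\overline{u}$ a nonzero constant, $\alpha_j \geq 1$ and pairwise distinct monic irreducible $\overline{f_j}\in(\mathbb{Z}/p\mathbb{Z})[X]$ ($k=0$ if $\overline{f}=0$). Set $\zeta_{f,p}(s) := \prod_{j=1}^k (1-p^{-\deg(\overline{f_j})s})^{-\alpha_j}$ and $\zeta_f(s):=\prod_{p\in\mathcal{P}_f}\zeta_{f,p}(s)$,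 a holomorphic function on $U$. The global zeta class of $f$ is the coset $Z_f := \zeta_f\cdot\mathcal{E}(U)$. *)

theory Defs
  imports
    "HOL-Complex_Analysis.Complex_Analysis"
    "HOL-Algebra.Algebra"
    "HOL-Number_Theory.Residues"
begin

definition halfplane :: "complex set" where
  "halfplane = {s. Re s > 1}"

text \<open>
  A meromorphic function on the half-plane is represented by its unique representative that is
  continuous at every point which is not a pole, \<open>0\<close> at the poles, and \<open>undefined\<close> outside
  the half-plane. The product of two such representatives has to be normalised again with
  \<^const>\<open>remove_sings\<close>, because a zero of one factor may cancel a pole of the other.
\<close>

definition mero_group :: "(complex \<Rightarrow> complex) monoid" where
  "mero_group =
     \<lparr>carrier = {f. f nicely_meromorphic_on halfplane \<and> f \<in> extensional halfplane \<and>
                    (\<exists>s\<in>halfplane. f s \<noteq> 0)},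
      mult = (\<lambda>f g. restrict (remove_sings (\<lambda>s. f s * g s)) halfplane),
      one = restrict (\<lambda>_. 1) halfplane\<rparr>"

definition euler_subgroup :: "(complex \<Rightarrow> complex) set" where
  "euler_subgroup =
     generate mero_group {restrict (\<lambda>s. 1 - of_nat a powr (- s)) halfplane | a::nat. a \<ge> 2}"

definition localization :: "nat \<Rightarrow> rat set" where
  "localization p = {of_int a / of_int b | a b. \<not> int p dvd b}"

definition integral_primes :: "rat poly \<Rightarrow> nat set" where
  "integral_primes f =
     {p. Factorial_Ring.prime p \<and> (\<forall>i. Polynomial.coeff f i \<in> localization p)}"

text \<open>
  The image of \<open>c\<close> in \<open>\<int>/p\<int>\<close>, meaningful for \<open>c \<in> localization p\<close>: as
  \<^const>\<open>quotient_of\<close> is in lowest terms, its denominator is then a unit modulo \<open>p\<close>.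
\<close>

definition rat_mod :: "nat \<Rightarrow> rat \<Rightarrow> int" where
  "rat_mod p c = (case quotient_of c of (a, b) \<Rightarrow>
     (a mod int p) \<otimes>\<^bsub>residue_ring (int p)\<^esub> inv\<^bsub>residue_ring (int p)\<^esub> (b mod int p))"

abbreviation Fp_poly :: "nat \<Rightarrow> int list ring" where
  "Fp_poly p \<equiv> poly_ring (residue_ring (int p))"

text \<open>In \<^theory>\<open>HOL-Algebra.Polynomials\<close> the coefficient of highest degree comes first.\<close>

definition reduce_mod :: "nat \<Rightarrow> rat poly \<Rightarrow> int list" where
  "reduce_mod p f = ring.normalize (residue_ring (int p)) (map (rat_mod p) (rev (coeffs f)))"

definition monic_irreducibles :: "nat \<Rightarrow> int list set" where
  "monic_irreducibles p =
     {g \<in> carrier (Fp_poly p). ring_irreducible\<^bsub>Fp_poly p\<^esub> g \<and>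
        Polynomials.lead_coeff g = \<one>\<^bsub>residue_ring (int p)\<^esub>}"

text \<open>
  A factorisation of \<open>h\<close> into a nonzero constant and powers of pairwise distinct monic
  irreducibles is encoded by the function \<open>\<alpha>\<close> assigning to each irreducible its exponent,
  with value \<open>0\<close> at everything that does not occur in the factorisation.
\<close>

definition is_factorization :: "nat \<Rightarrow> int list \<Rightarrow> (int list \<Rightarrow> nat) \<Rightarrow> bool" where
  "is_factorization p h \<alpha> \<longleftrightarrow>
     finite {g. \<alpha> g \<noteq> 0} \<and> {g. \<alpha> g \<noteq> 0} \<subseteq> monic_irreducibles p \<and>
     (\<exists>u \<in> carrier (residue_ring (int p)) - {\<zero>\<^bsub>residue_ring (int p)\<^esub>}.
        h = [u] \<otimes>\<^bsub>Fp_poly p\<^esub> (\<Otimes>\<^bsub>Fp_poly p\<^esub>g\<in>{g. \<alpha> g \<noteq> 0}. g [^]\<^bsub>Fp_poly p\<^esub> \<alpha> g))"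

definition exponents :: "nat \<Rightarrow> int list \<Rightarrow> int list \<Rightarrow> nat" where
  "exponents p h =
     (if h = \<zero>\<^bsub>Fp_poly p\<^esub> then (\<lambda>_. 0) else (THE \<alpha>. is_factorization p h \<alpha>))"

definition local_zeta :: "rat poly \<Rightarrow> nat \<Rightarrow> complex \<Rightarrow> complex" where
  "local_zeta f p s =
     (let \<alpha> = exponents p (reduce_mod p f) in
        \<Prod>g\<in>{g. \<alpha> g \<noteq> 0}.
          (1 - of_nat p powr (- (of_nat (Polynomials.degree g) * s))) powi (- int (\<alpha> g)))"

definition global_zeta :: "rat poly \<Rightarrow> complex \<Rightarrow> complex" where
  "global_zeta f =
     restrict
       (\<lambda>s. prodinf (\<lambda>p. if p \<in> integral_primes f then local_zeta f p s else 1)) halfplane"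

definition zeta_class :: "rat poly \<Rightarrow> (complex \<Rightarrow> complex) set" where
  "zeta_class f = global_zeta f <#\<^bsub>mero_group\<^esub> euler_subgroup"

end

theory Submission
  imports Defs
begin

text \<open>
  The class of the zeta function turns products of nonzero rational polynomials into products of
  classes. For all but finitely many primes \<open>p\<close> both \<open>f\<close> and \<open>g\<close> are \<open>p\<close>-integral with nonzero
  reduction; there reduction commutes with the product and, by unique factorisation over the
  field with \<open>p\<close> elements, exponents add, so the local factor of \<open>f * g\<close> is the product of
  those of \<open>f\<close> and \<open>g\<close>. At each of the remaining primes the discrepancy is a finite product of
  functions \<open>(1 - (p ^ d) powr - s) powi k\<close> and hence lies in the Euler subgroup. As the number of
  local irreducible factors is at most \<open>degree f\<close>, the local factor at \<open>p\<close> differs from \<open>1\<close> by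
  \<open>O(p powr - Re s)\<close> locally uniformly, so the Euler products converge to nonvanishing holomorphic
  functions on the half-plane.
\<close>

section \<open>Meromorphic functions on the half-plane\<close>

lemma open_halfplane: "open halfplane"
  unfolding halfplane_def by (rule open_halfspace_Re_gt)

lemma connected_halfplane: "connected halfplane"
  unfolding halfplane_def by (intro convex_connected convex_halfspace_Re_gt)

lemma halfplane_nonempty: "halfplane \<noteq> {}"
proof -
  have "2 \<in> halfplane" by (simp add: halfplane_def)
  then show ?thesis by blast
qed

text \<open>Openness of \<open>A\<close> turns equality on \<open>A\<close> into equality near each
  point, and poles and limits depend only on a punctured neighbourhood. This is used to pass between
  a function and its restriction to \<open>halfplane\<close>.\<close>

lemma nicely_meromorphic_on_cong:
  assumes "open A" "\<And>z. z \<in> A \<Longrightarrow> f z = g z" "f nicely_meromorphic_on A"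
  shows "g nicely_meromorphic_on A"
proof -
  have ev: "eventually (\<lambda>w. f w = g w) (at z)" if "z \<in> A" for z
    using eventually_at_in_open'[OF assms(1) that] by eventually_elim (rule assms(2))
  have "g meromorphic_on A"
    using assms(3) meromorphic_on_cong[OF ev refl] by (auto simp: nicely_meromorphic_on_def)
  moreover have "is_pole g z \<and> g z = 0 \<or> g \<midarrow>z\<rightarrow> g z" if z: "z \<in> A" for z
  proof -
    have "is_pole f z \<longleftrightarrow> is_pole g z" "f \<midarrow>z\<rightarrow> f z \<longleftrightarrow> g \<midarrow>z\<rightarrow> f z"
      by (intro is_pole_cong ev z refl, intro tendsto_cong ev z)
    then show ?thesis
      using assms(3) z by (auto simp: nicely_meromorphic_on_def assms(2))
  qed
  ultimately show ?thesis by (auto simp: nicely_meromorphic_on_def)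
qed

text \<open>The normalisation leaves no freedom at a single point: the value is 0 at a pole and the
  limit elsewhere, so it is determined by the values in a punctured neighbourhood. Identities
  therefore need checking only off a sparse set.\<close>

lemma nicely_meromorphic_on_eqI:
  assumes "f nicely_meromorphic_on A" "g nicely_meromorphic_on A" "open A"
    and "\<forall>\<^sub>\<approx>z\<in>A. f z = g z" "z \<in> A"
  shows "f z = g z"
proof -
  have ev: "eventually (\<lambda>w. f w = g w) (at z)"
    using assms by (simp add: eventually_cosparse_open_eq)
  have pole: "is_pole f z \<longleftrightarrow> is_pole g z"
    by (intro is_pole_cong ev refl)
  show ?thesis
  proof (cases "is_pole f z")
    case True
    then show ?thesis
      using pole is_pole_zero_at_nicely_mero[OF assms(1) _ assms(5)]
        is_pole_zero_at_nicely_mero[OF assms(2) _ assms(5)] by simp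
  next
    case False
    then have "f \<midarrow>z\<rightarrow> f z" "g \<midarrow>z\<rightarrow> g z"
      using assms pole by (auto simp: nicely_meromorphic_on_def)
    moreover have "f \<midarrow>z\<rightarrow> f z \<longleftrightarrow> g \<midarrow>z\<rightarrow> f z"
      by (intro tendsto_cong ev)
    ultimately show ?thesis
      using LIM_unique by blast
  qed
qed

lemma cosparse_halfplane_eq: "(\<forall>\<^sub>\<approx>z\<in>halfplane. restrict f halfplane z = f z)"
  using eventually_in_cosparse[of halfplane, OF order_refl open_halfplane]
  by eventually_elim simp

text \<open>By the identity theorem on the connected half-plane, one nonzero value forces the zeros
  to be sparse. The cosparse form can be combined with other cosparse conditions, which the
  existential form cannot.\<close>

lemma mero_group_carrier:
  "f \<in> carrier mero_group \<longleftrightarrow> f nicely_meromorphic_on halfplane \<and> f \<in> extensional halfplane \<and>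
     (\<forall>\<^sub>\<approx>z\<in>halfplane. f z \<noteq> 0)"
proof -
  have "(\<exists>s\<in>halfplane. f s \<noteq> 0) \<longleftrightarrow> (\<forall>\<^sub>\<approx>z\<in>halfplane. f z \<noteq> 0)"
    if "f nicely_meromorphic_on halfplane"
  proof
    assume "\<exists>s\<in>halfplane. f s \<noteq> 0"
    then show "\<forall>\<^sub>\<approx>z\<in>halfplane. f z \<noteq> 0"
      using nicely_meromorphic_imp_constant_or_avoid[OF that open_halfplane connected_halfplane, of 0]
      by blast
  next
    assume "\<forall>\<^sub>\<approx>z\<in>halfplane. f z \<noteq> 0"
    moreover have "\<forall>\<^sub>\<approx>z\<in>halfplane. z \<in> halfplane"
      by (rule eventually_in_cosparse[OF order_refl open_halfplane])
    ultimately have "\<forall>\<^sub>\<approx>z\<in>halfplane. z \<in> halfplane \<and> f z \<noteq> 0"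
      by eventually_elim simp
    then show "\<exists>s\<in>halfplane. f s \<noteq> 0"
      using halfplane_nonempty by (auto dest!: eventually_happens)
  qed
  then show ?thesis
    by (auto simp: mero_group_def)
qed

text \<open>Normalising with \<open>remove_sings\<close> changes a meromorphic function only on a
  sparse set.\<close>

lemma mero_group_mult_cosparse:
  assumes "f \<in> carrier mero_group" "g \<in> carrier mero_group"
  shows "\<forall>\<^sub>\<approx>z\<in>halfplane. (f \<otimes>\<^bsub>mero_group\<^esub> g) z = f z * g z"
proof -
  have "(\<lambda>z. f z * g z) meromorphic_on halfplane"
    using assms by (auto simp: mero_group_carrier nicely_meromorphic_on_def intro!: meromorphic_intros)
  then have "\<forall>\<^sub>\<approx>z\<in>halfplane. remove_sings (\<lambda>z. f z * g z) z = f z * g z"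
    by (rule eventually_remove_sings_eq)
  then show ?thesis
    using cosparse_halfplane_eq[of "remove_sings (\<lambda>z. f z * g z)"]
    by eventually_elim (simp add: mero_group_def)
qed

lemma mero_group_mult_closed:
  assumes "f \<in> carrier mero_group" "g \<in> carrier mero_group"
  shows "f \<otimes>\<^bsub>mero_group\<^esub> g \<in> carrier mero_group"
proof -
  have "(\<lambda>z. f z * g z) meromorphic_on halfplane"
    using assms by (auto simp: mero_group_carrier nicely_meromorphic_on_def intro!: meromorphic_intros)
  then have "f \<otimes>\<^bsub>mero_group\<^esub> g nicely_meromorphic_on halfplane"
    by (intro nicely_meromorphic_on_cong[OF open_halfplane _ remove_sings_nicely_meromorphic])
       (auto simp: mero_group_def)
  moreover have "\<forall>\<^sub>\<approx>z\<in>halfplane. f z \<noteq> 0" "\<forall>\<^sub>\<approx>z\<in>halfplane. g z \<noteq> 0"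
    using assms by (auto simp: mero_group_carrier)
  then have "\<forall>\<^sub>\<approx>z\<in>halfplane. (f \<otimes>\<^bsub>mero_group\<^esub> g) z \<noteq> 0"
    using mero_group_mult_cosparse[OF assms] by eventually_elim simp
  moreover have "f \<otimes>\<^bsub>mero_group\<^esub> g \<in> extensional halfplane"
    by (simp add: mero_group_def)
  ultimately show ?thesis by (simp add: mero_group_carrier)
qed

lemma mero_group_eqI:
  assumes "f \<in> carrier mero_group" "g \<in> carrier mero_group"
    and "\<forall>\<^sub>\<approx>z\<in>halfplane. f z = g z"
  shows "f = g"
  using assms nicely_meromorphic_on_eqI[OF _ _ open_halfplane assms(3)]
  by (intro extensionalityI[of f halfplane g]) (auto simp: mero_group_carrier)

lemma restrict_holomorphic_in_mero_group:
  assumes "f holomorphic_on halfplane" "\<And>z. z \<in> halfplane \<Longrightarrow> f z \<noteq> 0"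
  shows "restrict f halfplane \<in> carrier mero_group"
proof -
  have "f nicely_meromorphic_on halfplane"
    by (rule analytic_on_imp_nicely_meromorphic_on)
       (rule iffD2[OF analytic_on_open[OF open_halfplane] assms(1)])
  then have "restrict f halfplane nicely_meromorphic_on halfplane"
    by (rule nicely_meromorphic_on_cong[OF open_halfplane, rotated]) simp
  moreover have "\<forall>\<^sub>\<approx>z\<in>halfplane. restrict f halfplane z \<noteq> 0"
    using eventually_in_cosparse[OF order_refl open_halfplane]
    by eventually_elim (simp add: assms(2))
  ultimately show ?thesis by (simp add: mero_group_carrier)
qed

lemma one_mero_group: "\<one>\<^bsub>mero_group\<^esub> = restrict (\<lambda>_. 1) halfplane"
  by (simp add: mero_group_def)

text \<open>A product of holomorphic functions has no singularity to remove, so here the group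
  operation is honest pointwise multiplication.\<close>

lemma mult_mero_group_holomorphic:
  assumes "f holomorphic_on halfplane" "g holomorphic_on halfplane"
  shows "restrict f halfplane \<otimes>\<^bsub>mero_group\<^esub> restrict g halfplane
           = restrict (\<lambda>z. f z * g z) halfplane"
proof -
  have "remove_sings (\<lambda>s. restrict f halfplane s * restrict g halfplane s) z = f z * g z"
    if z: "z \<in> halfplane" for z
  proof -
    have "eventually (\<lambda>s. restrict f halfplane s * restrict g halfplane s = f s * g s) (at z)"
      using eventually_at_in_open'[OF open_halfplane z] by eventually_elim simp
    then have "remove_sings (\<lambda>s. restrict f halfplane s * restrict g halfplane s) z
                 = remove_sings (\<lambda>s. f s * g s) z"
      by (rule remove_sings_cong) simp
    also have "\<dots> = f z * g z"
      using assms open_halfplane z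
      by (intro remove_sings_at_analytic analytic_intros)
         (auto intro: holomorphic_on_imp_analytic_at)
    finally show ?thesis .
  qed
  then show ?thesis
    by (auto simp: mero_group_def restrict_def)
qed

text \<open>By \<open>mero_group_eqI\<close> the unit, inverse and associativity laws reduce to
  field identities that hold off a sparse set.\<close>

lemma comm_group_mero_group: "comm_group mero_group"
proof (rule comm_groupI)
  show one: "\<one>\<^bsub>mero_group\<^esub> \<in> carrier mero_group"
    unfolding one_mero_group by (rule restrict_holomorphic_in_mero_group) auto
  fix f assume f: "f \<in> carrier mero_group"
  have one_ev: "\<forall>\<^sub>\<approx>z\<in>halfplane. \<one>\<^bsub>mero_group\<^esub> z = 1"
    using cosparse_halfplane_eq[of "\<lambda>_. 1"] unfolding one_mero_group .
  show "\<one>\<^bsub>mero_group\<^esub> \<otimes>\<^bsub>mero_group\<^esub> f = f"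
  proof (rule mero_group_eqI)
    show "\<forall>\<^sub>\<approx>z\<in>halfplane. (\<one>\<^bsub>mero_group\<^esub> \<otimes>\<^bsub>mero_group\<^esub> f) z = f z"
      using mero_group_mult_cosparse[OF one f] one_ev by eventually_elim simp
  qed (use f one in \<open>auto intro: mero_group_mult_closed\<close>)
  show "\<exists>g\<in>carrier mero_group. g \<otimes>\<^bsub>mero_group\<^esub> f = \<one>\<^bsub>mero_group\<^esub>"
  proof
    \<comment> \<open>The convention \<open>inverse 0 = 0\<close> gives the normalised values: at a
      zero of \<open>f\<close> the reciprocal has a pole and value 0, and at a pole of
      \<open>f\<close> the stored value 0 becomes the limit 0.\<close>
    let ?g = "restrict (\<lambda>z. inverse (f z)) halfplane"
    have nz: "\<forall>\<^sub>\<approx>z\<in>halfplane. f z \<noteq> 0" using f by (simp add: mero_group_carrier)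
    have g_ev: "\<forall>\<^sub>\<approx>z\<in>halfplane. ?g z = inverse (f z)"
      by (rule cosparse_halfplane_eq)
    have "?g nicely_meromorphic_on halfplane"
      by (rule nicely_meromorphic_on_cong[OF open_halfplane _ nicely_meromorphic_on_inverse[of f]])
        (use f in \<open>simp_all add: mero_group_carrier\<close>)
    moreover have "\<forall>\<^sub>\<approx>z\<in>halfplane. ?g z \<noteq> 0"
      using nz g_ev by eventually_elim auto
    ultimately show g: "?g \<in> carrier mero_group" by (simp add: mero_group_carrier)
    show "?g \<otimes>\<^bsub>mero_group\<^esub> f = \<one>\<^bsub>mero_group\<^esub>"
    proof (rule mero_group_eqI)
      show "\<forall>\<^sub>\<approx>z\<in>halfplane. (?g \<otimes>\<^bsub>mero_group\<^esub> f) z = \<one>\<^bsub>mero_group\<^esub> z"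
        using mero_group_mult_cosparse[OF g f] one_ev g_ev nz by eventually_elim simp
    qed (use f g one in \<open>auto intro: mero_group_mult_closed\<close>)
  qed
  fix g assume g: "g \<in> carrier mero_group"
  show fg: "f \<otimes>\<^bsub>mero_group\<^esub> g \<in> carrier mero_group"
    using f g by (rule mero_group_mult_closed)
  show "f \<otimes>\<^bsub>mero_group\<^esub> g = g \<otimes>\<^bsub>mero_group\<^esub> f"
    by (simp add: mero_group_def mult.commute)
  fix h assume h: "h \<in> carrier mero_group"
  have gh: "g \<otimes>\<^bsub>mero_group\<^esub> h \<in> carrier mero_group"
    using g h by (rule mero_group_mult_closed)
  show "f \<otimes>\<^bsub>mero_group\<^esub> g \<otimes>\<^bsub>mero_group\<^esub> h = f \<otimes>\<^bsub>mero_group\<^esub> (g \<otimes>\<^bsub>mero_group\<^esub> h)"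
  proof (rule mero_group_eqI)
    show "\<forall>\<^sub>\<approx>z\<in>halfplane. (f \<otimes>\<^bsub>mero_group\<^esub> g \<otimes>\<^bsub>mero_group\<^esub> h) z
             = (f \<otimes>\<^bsub>mero_group\<^esub> (g \<otimes>\<^bsub>mero_group\<^esub> h)) z"
      using mero_group_mult_cosparse[OF f g] mero_group_mult_cosparse[OF g h]
        mero_group_mult_cosparse[OF fg h] mero_group_mult_cosparse[OF f gh]
      by eventually_elim simp
  qed (use f fg gh h in \<open>auto intro: mero_group_mult_closed\<close>)
qed

interpretation mero: comm_group mero_group
  by (rule comm_group_mero_group)

section \<open>Zero-free holomorphic functions and the Euler subgroup\<close>

definition nonvanishing :: "(complex \<Rightarrow> complex) \<Rightarrow> bool" where
  "nonvanishing f \<longleftrightarrow> f holomorphic_on halfplane \<and> (\<forall>s\<in>halfplane. f s \<noteq> 0)"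

text \<open>Membership is phrased for functions on all of the complex plane, so that closure under
  pointwise products, powers and inverses can be applied directly to explicit formulas, without
  \<open>restrict\<close> and \<open>remove_sings\<close>.\<close>

definition euler_function :: "(complex \<Rightarrow> complex) \<Rightarrow> bool" where
  "euler_function f \<longleftrightarrow> nonvanishing f \<and> restrict f halfplane \<in> euler_subgroup"

lemma nonvanishing_in_mero_group:
  "nonvanishing f \<Longrightarrow> restrict f halfplane \<in> carrier mero_group"
  by (auto simp: nonvanishing_def intro: restrict_holomorphic_in_mero_group)

lemma nonvanishing_mult: "nonvanishing f \<Longrightarrow> nonvanishing g \<Longrightarrow> nonvanishing (\<lambda>s. f s * g s)"
  by (auto simp: nonvanishing_def intro!: holomorphic_intros)

lemma nonvanishing_inverse: "nonvanishing f \<Longrightarrow> nonvanishing (\<lambda>s. inverse (f s))"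
  by (auto simp: nonvanishing_def intro!: holomorphic_intros)

lemma mult_mero_group_nonvanishing:
  "nonvanishing f \<Longrightarrow> nonvanishing g \<Longrightarrow>
     restrict f halfplane \<otimes>\<^bsub>mero_group\<^esub> restrict g halfplane
       = restrict (\<lambda>z. f z * g z) halfplane"
  by (simp add: nonvanishing_def mult_mero_group_holomorphic)

lemma inv_mero_group_nonvanishing:
  assumes "nonvanishing f"
  shows "inv\<^bsub>mero_group\<^esub> (restrict f halfplane) = restrict (\<lambda>z. inverse (f z)) halfplane"
proof (rule mero.inv_equality)
  show "restrict (\<lambda>z. inverse (f z)) halfplane \<otimes>\<^bsub>mero_group\<^esub> restrict f halfplane
          = \<one>\<^bsub>mero_group\<^esub>"
    using assms
    by (simp add: mult_mero_group_nonvanishing nonvanishing_inverse one_mero_group)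
       (auto simp: nonvanishing_def restrict_def)
qed (use assms in \<open>auto intro: nonvanishing_in_mero_group nonvanishing_inverse\<close>)

lemma powr_minus_lt_1:
  assumes "a \<ge> 2" "Re s > 1"
  shows "norm (of_nat a powr (- s) :: complex) < 1"
proof -
  have "real a powr (- Re s) < real a powr 0"
    using assms by (intro powr_less_mono) auto
  then show ?thesis
    using assms by (simp add: norm_powr_real_powr)
qed

text \<open>A zero would force \<open>a powr (- s)\<close> to have norm 1, whereas its norm is
  \<open>a powr (- Re s)\<close> and hence below 1 on the half-plane.\<close>

lemma nonvanishing_one_minus_powr:
  assumes "a \<ge> (2::nat)"
  shows "nonvanishing (\<lambda>s. 1 - of_nat a powr (- s))"
proof -
  have "1 - of_nat a powr (- s) \<noteq> (0::complex)" if "s \<in> halfplane" for s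
  proof
    assume "1 - of_nat a powr (- s) = (0::complex)"
    then have "norm (of_nat a powr (- s) :: complex) = 1"
      by (metis eq_iff_diff_eq_0 norm_one)
    then show False
      using powr_minus_lt_1[OF assms, of s] that by (simp add: halfplane_def)
  qed
  moreover have "(\<lambda>s. of_nat a powr (- s) :: complex) holomorphic_on halfplane"
    using assms by (intro holomorphic_on_powr_right holomorphic_intros) auto
  then have "(\<lambda>s. 1 - of_nat a powr (- s) :: complex) holomorphic_on halfplane"
    by (rule holomorphic_on_diff[OF holomorphic_on_const])
  ultimately show ?thesis
    by (simp add: nonvanishing_def)
qed

lemma euler_generators:
  "{restrict (\<lambda>s. 1 - of_nat a powr (- s)) halfplane | a::nat. a \<ge> 2} \<subseteq> carrier mero_group"
  by (auto intro: nonvanishing_in_mero_group nonvanishing_one_minus_powr)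

lemma subgroup_euler: "subgroup euler_subgroup mero_group"
  unfolding euler_subgroup_def by (intro mero.generate_is_subgroup euler_generators)

lemma euler_function_generator:
  "a \<ge> (2::nat) \<Longrightarrow> euler_function (\<lambda>s. 1 - of_nat a powr (- s))"
  unfolding euler_function_def euler_subgroup_def
  by (auto intro: nonvanishing_one_minus_powr generate.incl)

lemma euler_function_one: "euler_function (\<lambda>_. 1)"
  using subgroup.one_closed[OF subgroup_euler]
  by (simp add: euler_function_def nonvanishing_def one_mero_group)

lemma euler_function_mult:
  "euler_function f \<Longrightarrow> euler_function g \<Longrightarrow> euler_function (\<lambda>s. f s * g s)"
  using subgroup.m_closed[OF subgroup_euler]
  by (auto simp: euler_function_def nonvanishing_mult simp flip: mult_mero_group_nonvanishing)

lemma euler_function_inverse: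
  "euler_function f \<Longrightarrow> euler_function (\<lambda>s. inverse (f s))"
  using subgroup.m_inv_closed[OF subgroup_euler]
  by (auto simp: euler_function_def nonvanishing_inverse simp flip: inv_mero_group_nonvanishing)

lemma euler_function_power: "euler_function f \<Longrightarrow> euler_function (\<lambda>s. f s ^ n)"
  by (induction n) (auto intro: euler_function_one euler_function_mult)

lemma euler_function_prod:
  "(\<And>i. i \<in> I \<Longrightarrow> euler_function (f i)) \<Longrightarrow> euler_function (\<lambda>s. \<Prod>i\<in>I. f i s)"
  by (induction I rule: infinite_finite_induct) (auto intro: euler_function_one euler_function_mult)

section \<open>Factorisation of polynomials over a prime field\<close>

text \<open>With \<open>P\<close> as the implicit structure, unadorned ring symbols refer to the
  polynomial ring; the prefix \<open>F\<close> gives access to the coefficient field.\<close>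

locale prime_poly_ring =
  fixes p :: nat and P (structure)
  assumes prime_p: "Factorial_Ring.prime p"
  defines P_def: "P \<equiv> Fp_poly p"

sublocale prime_poly_ring \<subseteq> F: residues_prime p "residue_ring (int p)"
  using prime_p by unfold_locales

sublocale prime_poly_ring \<subseteq> principal_domain P
  unfolding P_def by (rule F.univ_poly_is_principal[OF F.carrier_is_subfield])

context prime_poly_ring
begin

abbreviation R where "R \<equiv> residue_ring (int p)"

lemma carrier_polynomial: "h \<in> carrier P \<longleftrightarrow> polynomial\<^bsub>R\<^esub> (carrier R) h"
  by (simp add: P_def univ_poly_carrier)

lemma mult_eq: "g \<otimes> h = F.poly_mult g h"
  by (simp add: P_def univ_poly_mult)

lemma zero_eq: "\<zero> = []" and one_eq: "\<one> = [\<one>\<^bsub>R\<^esub>]"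
  by (simp_all add: P_def univ_poly_zero univ_poly_one)

lemma Units_iff: "h \<in> Units P \<longleftrightarrow> (\<exists>u \<in> carrier R - {\<zero>\<^bsub>R\<^esub>}. h = [u])"
  using F.univ_poly_carrier_units by (auto simp: P_def)

lemma degree_mult:
  assumes "g \<in> carrier P" "h \<in> carrier P" "g \<noteq> []" "h \<noteq> []"
  shows "Polynomials.degree (g \<otimes> h) = Polynomials.degree g + Polynomials.degree h"
  using F.poly_mult_degree_eq[OF F.carrier_is_subring, of g h] assms
  by (simp add: carrier_polynomial mult_eq)

lemma lead_coeff_mult:
  assumes "g \<in> carrier P" "h \<in> carrier P" "g \<noteq> []" "h \<noteq> []"
  shows "Polynomials.lead_coeff (g \<otimes> h)
           = Polynomials.lead_coeff g \<otimes>\<^bsub>R\<^esub> Polynomials.lead_coeff h"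
  using F.poly_mult_lead_coeff[OF F.carrier_is_subring, of g h] assms
  by (simp add: carrier_polynomial mult_eq)

lemma lead_coeff_closed:
  assumes "h \<in> carrier P" "h \<noteq> []"
  shows "Polynomials.lead_coeff h \<in> carrier R - {\<zero>\<^bsub>R\<^esub>}"
  using assms by (cases h) (auto simp: carrier_polynomial polynomial_def)

text \<open>Irreducible elements of a principal ideal domain are prime; primality is what drives the
  uniqueness of factorisations below.\<close>

lemma monic_irreduciblesD:
  assumes "g \<in> monic_irreducibles p"
  shows "g \<in> carrier P" "g \<noteq> []" "ring_irreducible g" "ring_prime g" "g \<notin> Units P"
    "Polynomials.lead_coeff g = \<one>\<^bsub>R\<^esub>"
proof -
  show g: "g \<in> carrier P" "ring_irreducible g" "Polynomials.lead_coeff g = \<one>\<^bsub>R\<^esub>"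
    using assms by (auto simp: monic_irreducibles_def P_def)
  show "ring_prime g" using g primeness_condition by blast
  show "g \<noteq> []" "g \<notin> Units P"
    using ring_irreducibleE(1,4)[OF g(1,2)] by (auto simp: zero_eq)
qed

text \<open>A nonzero polynomial of degree 0 over a field is a unit, hence not irreducible. The
  bound makes \<open>p ^ d\<close> an admissible base of a generator and limits the number of
  factors by the degree.\<close>

lemma degree_monic_irreducible:
  assumes "g \<in> monic_irreducibles p"
  shows "Polynomials.degree g \<ge> 1"
  using monic_irreduciblesD[OF assms] F.univ_poly_units'[OF F.carrier_is_subfield, of g]
  by (auto simp: P_def)

text \<open>Irreducibility of \<open>h\<close> makes the cofactor a unit, that is a nonzero
  constant, and comparing leading coefficients shows that this constant is 1.\<close>

lemma monic_irreducible_divides_imp_eq: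
  assumes "g \<in> monic_irreducibles p" "h \<in> monic_irreducibles p" "g divides h"
  shows "g = h"
proof -
  note g = monic_irreduciblesD[OF assms(1)] and h = monic_irreduciblesD[OF assms(2)]
  obtain c where c: "c \<in> carrier P" "h = g \<otimes> c"
    using assms(3) by (auto simp: factor_def)
  then have "c \<in> Units P"
    using ring_irreducibleE(5)[OF h(1,3) g(1)] g(5) by blast
  then obtain u where u: "u \<in> carrier R - {\<zero>\<^bsub>R\<^esub>}" "c = [u]"
    by (auto simp: Units_iff)
  have "\<one>\<^bsub>R\<^esub> \<otimes>\<^bsub>R\<^esub> u = \<one>\<^bsub>R\<^esub>"
    using lead_coeff_mult[OF g(1) c(1) g(2)] u c(2) g(6) h(6) by simp
  then have "c = \<one>"
    using u by (simp add: one_eq)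
  then show ?thesis using c g(1) by simp
qed

section \<open>Factorisations encoded by exponent functions\<close>

definition exponent_fun :: "(int list \<Rightarrow> nat) \<Rightarrow> bool" where
  "exponent_fun \<alpha> \<longleftrightarrow> finite {g. \<alpha> g \<noteq> 0} \<and> {g. \<alpha> g \<noteq> 0} \<subseteq> monic_irreducibles p"

definition power_prod :: "(int list \<Rightarrow> nat) \<Rightarrow> int list" where
  "power_prod \<alpha> = (\<Otimes>g\<in>{g. \<alpha> g \<noteq> 0}. g [^] \<alpha> g)"

text \<open>Over a field the nonzero constants are exactly the units of the polynomial ring, so
  factorisations can be handled by divisibility theory alone.\<close>

lemma is_factorization_iff:
  "is_factorization p h \<alpha> \<longleftrightarrow> exponent_fun \<alpha> \<and> (\<exists>u\<in>Units P. h = u \<otimes> power_prod \<alpha>)"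
proof -
  have "(\<exists>u\<in>Units P. Q u) \<longleftrightarrow> (\<exists>u\<in>carrier R - {\<zero>\<^bsub>R\<^esub>}. Q [u])" for Q
    using Units_iff by auto
  then show ?thesis
    by (simp add: is_factorization_def exponent_fun_def power_prod_def P_def)
qed

lemma exponent_fun_closed:
  "exponent_fun \<alpha> \<Longrightarrow> \<alpha> g \<noteq> 0 \<Longrightarrow> g \<in> carrier P"
  using monic_irreduciblesD(1) by (auto simp: exponent_fun_def)

text \<open>Indices with exponent 0 contribute the factor 1. Enlarging the index set allows exponent
  functions with different supports to be compared over the union.\<close>

lemma power_prod_superset:
  assumes "finite S" "{g. \<alpha> g \<noteq> 0} \<subseteq> S" "S \<subseteq> carrier P"
  shows "power_prod \<alpha> = (\<Otimes>g\<in>S. g [^] \<alpha> g)"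
  unfolding power_prod_def using assms by (intro finprod_mono_neutral_cong_left) auto

lemma power_prod_closed: "exponent_fun \<alpha> \<Longrightarrow> power_prod \<alpha> \<in> carrier P"
  unfolding power_prod_def by (intro finprod_closed) (auto intro: exponent_fun_closed)

lemma exponent_fun_add:
  assumes "exponent_fun \<alpha>" "exponent_fun \<beta>"
  shows "exponent_fun (\<lambda>g. \<alpha> g + \<beta> g)"
proof -
  have "{g. \<alpha> g + \<beta> g \<noteq> 0} = {g. \<alpha> g \<noteq> 0} \<union> {g. \<beta> g \<noteq> 0}" by auto
  then show ?thesis using assms by (simp add: exponent_fun_def)
qed

lemma power_prod_add:
  assumes "exponent_fun \<alpha>" "exponent_fun \<beta>"
  shows "power_prod (\<lambda>g. \<alpha> g + \<beta> g) = power_prod \<alpha> \<otimes> power_prod \<beta>"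
proof -
  let ?S = "{g. \<alpha> g \<noteq> 0} \<union> {g. \<beta> g \<noteq> 0}"
  have S: "finite ?S" "?S \<subseteq> carrier P"
    using assms exponent_fun_closed by (auto simp: exponent_fun_def)
  have "power_prod (\<lambda>g. \<alpha> g + \<beta> g) = (\<Otimes>g\<in>?S. g [^] (\<alpha> g + \<beta> g))"
    using S by (intro power_prod_superset) auto
  also have "\<dots> = (\<Otimes>g\<in>?S. g [^] \<alpha> g \<otimes> g [^] \<beta> g)"
    using S by (intro finprod_cong') (auto simp: nat_pow_mult subset_iff)
  also have "\<dots> = (\<Otimes>g\<in>?S. g [^] \<alpha> g) \<otimes> (\<Otimes>g\<in>?S. g [^] \<beta> g)"
    using S by (intro finprod_multf) auto
  also have "(\<Otimes>g\<in>?S. g [^] \<alpha> g) = power_prod \<alpha>"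
    using S by (intro power_prod_superset[symmetric]) auto
  also have "(\<Otimes>g\<in>?S. g [^] \<beta> g) = power_prod \<beta>"
    using S by (intro power_prod_superset[symmetric]) auto
  finally show ?thesis .
qed

lemma exponent_fun_single: "g \<in> monic_irreducibles p \<Longrightarrow> exponent_fun (\<lambda>h. of_bool (h = g))"
  by (simp add: exponent_fun_def)

lemma power_prod_single:
  assumes "g \<in> monic_irreducibles p"
  shows "power_prod (\<lambda>h. of_bool (h = g)) = g"
proof -
  note g = monic_irreduciblesD[OF assms]
  have "power_prod (\<lambda>h. of_bool (h = g)) = (\<Otimes>h\<in>{g}. h [^] (of_bool (h = g) :: nat))"
    using g by (intro power_prod_superset) auto
  then show ?thesis using g(1) by (simp add: Pi_def)
qed

lemma is_factorization_mult:
  assumes "is_factorization p g \<alpha>" "is_factorization p h \<beta>"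
  shows "is_factorization p (g \<otimes> h) (\<lambda>x. \<alpha> x + \<beta> x)"
proof -
  obtain u v where u: "u \<in> Units P" "g = u \<otimes> power_prod \<alpha>"
    and v: "v \<in> Units P" "h = v \<otimes> power_prod \<beta>"
    and ex: "exponent_fun \<alpha>" "exponent_fun \<beta>"
    using assms by (auto simp: is_factorization_iff)
  have "g \<otimes> h = (u \<otimes> v) \<otimes> power_prod (\<lambda>x. \<alpha> x + \<beta> x)"
    using u v ex power_prod_closed by (simp add: power_prod_add m_ac Units_closed)
  moreover have "u \<otimes> v \<in> Units P" using u v by simp
  ultimately show ?thesis
    using exponent_fun_add[OF ex] by (auto simp: is_factorization_iff)
qed

lemma is_factorization_closed:
  assumes "is_factorization p h \<alpha>"
  shows "h \<in> carrier P"
  using assms power_prod_closed by (auto simp: is_factorization_iff Units_closed)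

lemma prime_divides_mult:
  assumes "ring_prime g" "a \<in> carrier P" "b \<in> carrier P" "g divides a \<otimes> b"
  shows "g divides a \<or> g divides b"
  using assms by (auto simp: ring_prime_def prime_def)

lemma prime_not_divides_Unit:
  assumes "g \<in> carrier P" "ring_prime g" "u \<in> Units P"
  shows "\<not> g divides u"
  using divides_unit[of g u] assms by (auto simp: ring_prime_def prime_def)

lemma prime_divides_pow:
  assumes "ring_prime g" "g \<in> carrier P" "a \<in> carrier P" "g divides a [^] (n::nat)"
  shows "g divides a \<and> n \<noteq> 0"
  using assms(4)
proof (induction n)
  case 0
  then show ?case
    using prime_not_divides_Unit[OF assms(2,1) Units_one_closed] by simp
next
  case (Suc n)
  then show ?case
    using prime_divides_mult[OF assms(1), of "a [^] n" a] assms(3) by auto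
qed

lemma prime_divides_finprod:
  assumes "ring_prime g" "g \<in> carrier P" "finite S" "f \<in> S \<rightarrow> carrier P"
    and "g divides (\<Otimes>x\<in>S. f x)"
  shows "\<exists>x\<in>S. g divides f x"
  using assms(3,4,5)
proof (induction S rule: finite_induct)
  case empty
  then show ?case
    using prime_not_divides_Unit[OF assms(2,1) Units_one_closed] by simp
next
  case (insert x S)
  then show ?case
    using prime_divides_mult[OF assms(1), of "f x" "\<Otimes>x\<in>S. f x"] by auto
qed

text \<open>The prime \<open>g\<close> cannot divide the unit, so it divides one of the powers,
  hence its base, and distinct monic irreducibles do not divide each other.\<close>

lemma factorization_divides_imp_exponent:
  assumes "is_factorization p h \<alpha>" "g \<in> monic_irreducibles p" "g divides h"
  shows "\<alpha> g \<noteq> 0"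
proof -
  note g = monic_irreduciblesD[OF assms(2)]
  obtain u where u: "u \<in> Units P" "h = u \<otimes> power_prod \<alpha>" and ex: "exponent_fun \<alpha>"
    using assms by (auto simp: is_factorization_iff)
  have "g divides power_prod \<alpha>"
    using prime_divides_mult[OF g(4)] prime_not_divides_Unit[OF g(1,4) u(1)] u assms(3)
      power_prod_closed[OF ex] by blast
  then obtain x where x: "\<alpha> x \<noteq> 0" "g divides x [^] \<alpha> x"
    using prime_divides_finprod[OF g(4,1), of "{g. \<alpha> g \<noteq> 0}" "\<lambda>g. g [^] \<alpha> g"] ex
      exponent_fun_closed[OF ex]
    by (auto simp: exponent_fun_def power_prod_def)
  then have "g divides x"
    using prime_divides_pow[OF g(4,1)] exponent_fun_closed[OF ex] by blast
  then have "g = x"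
    using x ex assms(2) by (intro monic_irreducible_divides_imp_eq) (auto simp: exponent_fun_def)
  with x show ?thesis by simp
qed

text \<open>Splitting \<alpha> as the indicator of \<open>g\<close> plus a remainder splits off one
  factor \<open>g\<close>. This is the descent step for uniqueness.\<close>

lemma factorization_cancel:
  assumes "is_factorization p h \<alpha>" "\<alpha> g \<noteq> 0"
  shows "\<exists>h'. h = g \<otimes> h' \<and> is_factorization p h' (\<alpha>(g := \<alpha> g - 1))"
proof -
  let ?\<alpha> = "\<alpha>(g := \<alpha> g - 1)"
  obtain u where u: "u \<in> Units P" "h = u \<otimes> power_prod \<alpha>" and ex: "exponent_fun \<alpha>"
    using assms by (auto simp: is_factorization_iff)
  have g: "g \<in> monic_irreducibles p" using ex assms(2) by (auto simp: exponent_fun_def)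
  have "{x. ?\<alpha> x \<noteq> 0} \<subseteq> {x. \<alpha> x \<noteq> 0}" using assms(2) by auto
  then have ex': "exponent_fun ?\<alpha>"
    using ex finite_subset unfolding exponent_fun_def by blast
  have "\<alpha> = (\<lambda>x. of_bool (x = g) + ?\<alpha> x)" using assms(2) by auto
  then have "power_prod \<alpha> = g \<otimes> power_prod ?\<alpha>"
    using power_prod_add[OF exponent_fun_single[OF g] ex'] power_prod_single[OF g] by simp
  then have "h = g \<otimes> (u \<otimes> power_prod ?\<alpha>)"
    using u monic_irreduciblesD(1)[OF g] power_prod_closed[OF ex'] by (simp add: m_ac Units_closed)
  then show ?thesis
    using ex' u(1) by (auto simp: is_factorization_iff)
qed

text \<open>Induction on the total exponent of \<alpha>: a factor occurring in one factorisation
  divides \<open>h\<close>, so it occurs in the other, and it can be cancelled from both.\<close>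

lemma factorization_unique:
  assumes "is_factorization p h \<alpha>" "is_factorization p h \<beta>"
  shows "\<alpha> = \<beta>"
proof -
  define n where "n = (\<Sum>g | \<alpha> g \<noteq> 0. \<alpha> g)"
  show ?thesis using n_def assms
  proof (induction n arbitrary: h \<alpha> \<beta>)
    case 0
    then have "\<alpha> g = 0" for g
      by (auto simp: is_factorization_def)
    moreover have "\<beta> g = 0" for g
    proof (rule ccontr)
      \<comment> \<open>As \<alpha> is zero everywhere, no monic irreducible can divide
        \<open>h\<close>, but this one would.\<close>
      assume g: "\<beta> g \<noteq> 0"
      then obtain h' where "h = g \<otimes> h'" "is_factorization p h' (\<beta>(g := \<beta> g - 1))"
        using factorization_cancel[OF 0(3)] by blast
      then have "g divides h"
        using is_factorization_closed by (auto simp: factor_def)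
      then show False
        using factorization_divides_imp_exponent[OF 0(2), of g] g 0(3) \<open>\<And>g. \<alpha> g = 0\<close>
        by (auto simp: is_factorization_def)
    qed
    ultimately show ?case by (simp add: fun_eq_iff)
  next
    case (Suc n)
    then have fin: "finite {g. \<alpha> g \<noteq> 0}" by (auto simp: is_factorization_def)
    obtain g where g: "\<alpha> g \<noteq> 0"
    proof (rule ccontr)
      assume "\<not> thesis"
      then have "{g. \<alpha> g \<noteq> 0} = {}" using that by blast
      then show False using Suc.prems(1) by simp
    qed
    then obtain h' where h': "h = g \<otimes> h'" "is_factorization p h' (\<alpha>(g := \<alpha> g - 1))"
      using factorization_cancel[OF Suc.prems(2)] by blast
    have gm: "g \<in> monic_irreducibles p" using g Suc.prems(2) by (auto simp: is_factorization_def)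
    note g' = monic_irreduciblesD[OF gm]
    have "g divides h" using h' is_factorization_closed by (auto simp: factor_def)
    then have \<beta>g: "\<beta> g \<noteq> 0"
      using factorization_divides_imp_exponent[OF Suc.prems(3) gm] by simp
    then obtain h'' where h'': "h = g \<otimes> h''" "is_factorization p h'' (\<beta>(g := \<beta> g - 1))"
      using factorization_cancel[OF Suc.prems(3)] by blast
    \<comment> \<open>Cancelling \<open>g\<close> in the domain identifies the two cofactors, so the
      induction hypothesis applies to two factorisations of one polynomial.\<close>
    have "h' = h''"
      using h' h'' is_factorization_closed m_lcancel[of g h' h''] g'(1,2) by (simp add: zero_eq)
    moreover have "n = (\<Sum>x | (\<alpha>(g := \<alpha> g - 1)) x \<noteq> 0. (\<alpha>(g := \<alpha> g - 1)) x)"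
    proof -
      have "(\<Sum>x | (\<alpha>(g := \<alpha> g - 1)) x \<noteq> 0. (\<alpha>(g := \<alpha> g - 1)) x)
              = (\<Sum>x | \<alpha> x \<noteq> 0. (\<alpha>(g := \<alpha> g - 1)) x)"
        using fin g by (intro sum.mono_neutral_left) auto
      also have "\<dots> = (\<alpha> g - 1) + (\<Sum>x\<in>{x. \<alpha> x \<noteq> 0} - {g}. \<alpha> x)"
        using fin g by (subst sum.remove[of _ g]) auto
      moreover have "Suc n = \<alpha> g + (\<Sum>x\<in>{x. \<alpha> x \<noteq> 0} - {g}. \<alpha> x)"
        using fin g Suc.prems(1) sum.remove[of "{x. \<alpha> x \<noteq> 0}" g \<alpha>] by simp
      ultimately show ?thesis using g by simp
    qed
    ultimately have "\<alpha>(g := \<alpha> g - 1) = \<beta>(g := \<beta> g - 1)"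
      using Suc.IH h'(2) h''(2) by blast
    then have "\<alpha> x = \<beta> x" for x
      using g \<beta>g by (cases "x = g") (auto simp: fun_eq_iff dest: spec[of _ x])
    then show ?case by blast
  qed
qed

section \<open>Existence of factorisations and the exponents of a polynomial\<close>

lemma exists_monic_irreducible_divisor:
  assumes "h \<in> carrier P" "h \<noteq> []" "h \<notin> Units P"
  shows "\<exists>g\<in>monic_irreducibles p. g divides h"
proof -
  have "h \<in> carrier P - {\<zero>}" using assms by (simp add: zero_eq)
  from exists_irreducible_divisor[OF this assms(3)]
  obtain b where b: "b \<in> carrier P" "ring_irreducible b" "b divides h" .
  have b0: "b \<noteq> []" using ring_irreducibleE(1)[OF b(1,2)] by (simp add: zero_eq)
  \<comment> \<open>Scaling by the inverse leading coefficient makes \<open>b\<close> monic. As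
    \<open>[v]\<close> is a unit, irreducibility and divisibility of \<open>h\<close> carry over
    from \<open>b\<close> to \<open>g\<close>.\<close>
  define v where "v = inv\<^bsub>R\<^esub> (Polynomials.lead_coeff b)"
  note lc = lead_coeff_closed[OF b(1) b0]
  then have lcU: "Polynomials.lead_coeff b \<in> Units R" by (simp add: F.field_Units)
  then have v: "v \<in> Units R" "v \<otimes>\<^bsub>R\<^esub> Polynomials.lead_coeff b = \<one>\<^bsub>R\<^esub>"
    by (auto simp: v_def)
  then have vU: "[v] \<in> Units P" by (auto simp: Units_iff F.field_Units)
  define g where "g = [v] \<otimes> b"
  have gc: "g \<in> carrier P" using vU b(1) by (simp add: g_def Units_closed)
  have assoc: "b = inv [v] \<otimes> g"
    using vU b(1) by (simp add: g_def Units_closed m_assoc[symmetric])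
  have "ring_irreducible g"
  proof (rule ring_irreducibleI)
    show "g \<in> carrier P - {\<zero>}"
      using gc assoc b0 vU by (auto simp: zero_eq[symmetric])
    show "g \<notin> Units P"
      using ring_irreducibleE(4)[OF b(1,2)] assoc vU by auto
    fix x y assume xy: "x \<in> carrier P" "y \<in> carrier P" "g = x \<otimes> y"
    then have "b = (inv [v] \<otimes> x) \<otimes> y" using assoc vU by (simp add: m_assoc Units_closed)
    then have "inv [v] \<otimes> x \<in> Units P \<or> y \<in> Units P"
      using ring_irreducibleE(5)[OF b(1,2), of "inv [v] \<otimes> x" y] xy vU by simp
    moreover have "x \<in> Units P" if "inv [v] \<otimes> x \<in> Units P"
    proof -
      have "[v] \<otimes> (inv [v] \<otimes> x) \<in> Units P" using that vU by simp
      then show ?thesis using vU xy(1) by (simp add: m_assoc[symmetric] Units_closed)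
    qed
    ultimately show "x \<in> Units P \<or> y \<in> Units P" by blast
  qed
  moreover have "Polynomials.lead_coeff g = \<one>\<^bsub>R\<^esub>"
    using lead_coeff_mult[of "[v]" b] vU b(1) b0 v by (simp add: g_def Units_closed)
  ultimately have "g \<in> monic_irreducibles p"
    using gc by (simp add: monic_irreducibles_def P_def)
  moreover have "g divides h"
  proof -
    obtain c where "c \<in> carrier P" "h = b \<otimes> c" using b(3) by (auto simp: factor_def)
    then have "h = g \<otimes> (inv [v] \<otimes> c)" using assoc vU gc by (simp add: m_ac Units_closed)
    then show ?thesis using vU \<open>c \<in> carrier P\<close> by (auto simp: factor_def)
  qed
  ultimately show ?thesis by blast
qed

text \<open>Splitting off a monic irreducible divisor lowers the degree by at least 1 and raises the
  total exponent by exactly 1. The bound is carried along because the convergence of the Euler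
  product rests on it.\<close>

lemma exists_factorization:
  assumes "h \<in> carrier P" "h \<noteq> []"
  shows "\<exists>\<alpha>. is_factorization p h \<alpha> \<and> (\<Sum>g | \<alpha> g \<noteq> 0. \<alpha> g) \<le> Polynomials.degree h"
  using assms
proof (induction "Polynomials.degree h" arbitrary: h rule: less_induct)
  case less
  show ?case
  proof (cases "h \<in> Units P")
    case True
    then have "is_factorization p h (\<lambda>_. 0)"
      using less.prems by (auto simp: is_factorization_iff exponent_fun_def power_prod_def
          intro!: bexI[of _ h])
    then show ?thesis by (intro exI[of _ "\<lambda>_. 0"]) simp
  next
    case False
    then obtain g where g: "g \<in> monic_irreducibles p" "g divides h"
      using exists_monic_irreducible_divisor less.prems by blast
    note g' = monic_irreduciblesD[OF g(1)]
    obtain h' where h': "h' \<in> carrier P" "h = g \<otimes> h'" using g(2) by (auto simp: factor_def)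
    have h'0: "h' \<noteq> []"
      using h' less.prems(2) g'(1) by (auto simp: zero_eq[symmetric])
    have deg: "Polynomials.degree h = Polynomials.degree g + Polynomials.degree h'"
      using degree_mult[OF g'(1) h'(1) g'(2) h'0] h'(2) by simp
    then have "Polynomials.degree h' < Polynomials.degree h"
      using degree_monic_irreducible[OF g(1)] by linarith
    then obtain \<alpha> where \<alpha>: "is_factorization p h' \<alpha>"
      "(\<Sum>g | \<alpha> g \<noteq> 0. \<alpha> g) \<le> Polynomials.degree h'"
      using less.hyps[OF _ h'(1) h'0] by blast
    let ?\<beta> = "\<lambda>x. of_bool (x = g) + \<alpha> x"
    have "is_factorization p g (\<lambda>x. of_bool (x = g))"
      using exponent_fun_single[OF g(1)] power_prod_single[OF g(1)] g'(1)
      by (auto simp: is_factorization_iff intro!: bexI[of _ \<one>])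
    then have fac: "is_factorization p h ?\<beta>"
      using is_factorization_mult \<alpha>(1) h'(2) by simp
    have fin: "finite {x. \<alpha> x \<noteq> 0}" using \<alpha>(1) by (simp add: is_factorization_def)
    have "{x. ?\<beta> x \<noteq> 0} = insert g {x. \<alpha> x \<noteq> 0}" by auto
    then have "(\<Sum>x | ?\<beta> x \<noteq> 0. ?\<beta> x)
        = (\<Sum>x\<in>insert g {x. \<alpha> x \<noteq> 0}. of_bool (x = g)) + (\<Sum>x\<in>insert g {x. \<alpha> x \<noteq> 0}. \<alpha> x)"
      by (simp add: sum.distrib)
    also have "(\<Sum>x\<in>insert g {x. \<alpha> x \<noteq> 0}. of_bool (x = g)) = (1::nat)"
      using fin by (simp add: of_bool_def sum.delta)
    also have "(\<Sum>x\<in>insert g {x. \<alpha> x \<noteq> 0}. \<alpha> x) = (\<Sum>g | \<alpha> g \<noteq> 0. \<alpha> g)"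
      using fin by (intro sum.mono_neutral_right) auto
    finally have "(\<Sum>x | ?\<beta> x \<noteq> 0. ?\<beta> x) \<le> Polynomials.degree h"
      using \<alpha>(2) deg degree_monic_irreducible[OF g(1)] by simp
    then show ?thesis using fac by blast
  qed
qed

text \<open>Uniqueness is what gives the definite description in \<open>exponents\<close> its
  intended meaning.\<close>

lemma exponents_eq:
  assumes "is_factorization p h \<alpha>" "h \<noteq> []"
  shows "exponents p h = \<alpha>"
  using assms factorization_unique
  by (auto simp: exponents_def univ_poly_zero intro!: the_equality)

lemma is_factorization_exponents:
  assumes "h \<in> carrier P" "h \<noteq> []"
  shows "is_factorization p h (exponents p h)"
  using exists_factorization[OF assms] exponents_eq assms by auto

text \<open>The zero polynomial is covered through the conventions that its exponents vanish and its
  degree is 0, so later estimates need no case distinction on whether the reduction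
  vanishes.\<close>

lemma exponents_bounds:
  assumes "h \<in> carrier P"
  shows "finite {g. exponents p h g \<noteq> 0}" "{g. exponents p h g \<noteq> 0} \<subseteq> monic_irreducibles p"
    "(\<Sum>g | exponents p h g \<noteq> 0. exponents p h g) \<le> Polynomials.degree h"
proof -
  have "finite {g. exponents p h g \<noteq> 0} \<and> {g. exponents p h g \<noteq> 0} \<subseteq> monic_irreducibles p \<and>
    (\<Sum>g | exponents p h g \<noteq> 0. exponents p h g) \<le> Polynomials.degree h"
  proof (cases "h = []")
    case True
    then show ?thesis by (simp add: exponents_def univ_poly_zero)
  next
    case False
    then obtain \<alpha> where \<alpha>: "is_factorization p h \<alpha>"
      "(\<Sum>g | \<alpha> g \<noteq> 0. \<alpha> g) \<le> Polynomials.degree h"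
      using exists_factorization[OF assms] by blast
    then show ?thesis
      unfolding exponents_eq[OF \<alpha>(1) False] by (simp add: is_factorization_def)
  qed
  then show "finite {g. exponents p h g \<noteq> 0}" "{g. exponents p h g \<noteq> 0} \<subseteq> monic_irreducibles p"
    "(\<Sum>g | exponents p h g \<noteq> 0. exponents p h g) \<le> Polynomials.degree h"
    by auto
qed

lemma exponents_mult:
  assumes "g \<in> carrier P" "h \<in> carrier P" "g \<noteq> []" "h \<noteq> []"
  shows "exponents p (g \<otimes> h) = (\<lambda>x. exponents p g x + exponents p h x)"
proof (rule exponents_eq)
  show "is_factorization p (g \<otimes> h) (\<lambda>x. exponents p g x + exponents p h x)"
    using assms by (intro is_factorization_mult is_factorization_exponents)
  show "g \<otimes> h \<noteq> []"
    using assms integral[of g h] by (auto simp: zero_eq)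
qed

end

section \<open>Reduction modulo a prime\<close>

text \<open>If \<open>p\<close> divided the reduced denominator, cross-multiplying with a fraction
  whose denominator is prime to \<open>p\<close> would make \<open>p\<close> divide the numerator
  too, against coprimality.\<close>

lemma localization_iff:
  assumes "Factorial_Ring.prime p" "quotient_of c = (a, b)"
  shows "c \<in> localization p \<longleftrightarrow> \<not> int p dvd b"
proof
  have b: "b > 0" "coprime a b" "c = of_int a / of_int b"
    using assms(2) quotient_of_denom_pos quotient_of_coprime quotient_of_div by auto
  show "c \<in> localization p" if "\<not> int p dvd b"
    using that b(3) by (auto simp: localization_def)
  assume "c \<in> localization p"
  then obtain a' b' where ab': "c = of_int a' / of_int b'" "\<not> int p dvd b'"
    by (auto simp: localization_def)
  have "b' \<noteq> 0" using ab'(2) by auto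
  then have "(of_int (a * b') :: rat) = of_int (a' * b)"
    using b ab'(1) by (simp add: field_simps)
  then have eq: "a * b' = a' * b" by (simp only: of_int_eq_iff)
  show "\<not> int p dvd b"
  proof
    assume pb: "int p dvd b"
    then have "int p dvd a * b'" by (simp add: eq)
    then have "int p dvd a"
      using ab'(2) assms(1) by (simp add: prime_dvd_mult_iff)
    then show False
      using pb b(2) assms(1) coprime_common_divisor not_prime_unit[of "int p"]
      by (metis prime_nat_int_transfer)
  qed
qed

context prime_poly_ring
begin

lemma prime_not_dvd_mult: "\<not> int p dvd a \<Longrightarrow> \<not> int p dvd b \<Longrightarrow> \<not> int p dvd a * b"
  using prime_p by (simp add: prime_dvd_mult_iff)

text \<open>The congruence describes the residue without mentioning the inverse in the residue ring;
  all later arguments use only this description.\<close>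

lemma rat_mod_spec:
  assumes "c \<in> localization p" "quotient_of c = (a, b)"
  shows "rat_mod p c \<in> carrier R" "[rat_mod p c * b = a] (mod int p)"
proof -
  have "\<not> int p dvd b" using assms localization_iff[OF prime_p] by blast
  then have bU: "b mod int p \<in> Units R"
    using F.mod_in_res_units F.m_gt_one F.p_coprime_right_int by blast
  have eq: "rat_mod p c = (a mod int p) \<otimes>\<^bsub>R\<^esub> inv\<^bsub>R\<^esub> (b mod int p)"
    by (simp add: rat_mod_def assms(2))
  then show "rat_mod p c \<in> carrier R" using bU by simp
  have "rat_mod p c \<otimes>\<^bsub>R\<^esub> (b mod int p) = a mod int p"
    using bU by (simp add: eq F.m_assoc F.Units_closed)
  then show "[rat_mod p c * b = a] (mod int p)"
    by (simp add: F.res_mult_eq cong_def mod_simps)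
qed

lemma carrier_cong_eq:
  assumes "x \<in> carrier R" "y \<in> carrier R" "[x = y] (mod int p)"
  shows "x = y"
  using assms by (simp add: F.res_carrier_eq cong_def)

text \<open>Any fraction with denominator prime to \<open>p\<close> may be used, not only the
  reduced one. Sums and products can therefore be computed with the plain product of
  denominators.\<close>

lemma rat_mod_eqI:
  assumes "\<not> int p dvd b" "x \<in> carrier R" "[x * b = a] (mod int p)" "c = of_int a / of_int b"
  shows "rat_mod p c = x"
proof -
  have c: "c \<in> localization p" using assms(1,4) by (auto simp: localization_def)
  obtain a0 b0 where q: "quotient_of c = (a0, b0)" by (cases "quotient_of c") auto
  have b0: "b0 > 0" "c = of_int a0 / of_int b0"
    using q quotient_of_denom_pos quotient_of_div by auto
  have pb0: "\<not> int p dvd b0" using localization_iff[OF prime_p q] c by simp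
  have "b \<noteq> 0" using assms(1) by auto
  then have "(of_int (a * b0) :: rat) = of_int (a0 * b)"
    using b0 assms(4) by (simp add: field_simps)
  then have eq: "a * b0 = a0 * b" by (simp only: of_int_eq_iff)
  have "[x * b * b0 = a * b0] (mod int p)"
    using assms(3) by (rule cong_scalar_right)
  moreover have "[rat_mod p c * b0 * b = a0 * b] (mod int p)"
    using rat_mod_spec(2)[OF c q] by (rule cong_scalar_right)
  \<comment> \<open>Both congruences were multiplied up to the common denominator
    \<open>b * b0\<close>, which is invertible modulo \<open>p\<close> and hence cancels.\<close>
  ultimately have "[rat_mod p c * (b * b0) = x * (b * b0)] (mod int p)"
    by (simp add: cong_def eq mult_ac)
  moreover have "coprime (b * b0) (int p)"
    using prime_not_dvd_mult[OF assms(1) pb0] by (simp only: F.p_coprime_right_int not_False_eq_True)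
  ultimately have "[rat_mod p c = x] (mod int p)"
    by (simp add: cong_mult_rcancel)
  then show ?thesis
    using carrier_cong_eq rat_mod_spec(1)[OF c q] assms(2) by blast
qed

lemma rat_mod_closed: "c \<in> localization p \<Longrightarrow> rat_mod p c \<in> carrier R"
  using rat_mod_spec(1) by (cases "quotient_of c") auto

lemma localizationE:
  assumes "c \<in> localization p"
  obtains a b where "c = of_int a / of_int b" "\<not> int p dvd b" "[rat_mod p c * b = a] (mod int p)"
proof -
  obtain a b where q: "quotient_of c = (a, b)" by (cases "quotient_of c") auto
  show ?thesis
    using that[of a b] q quotient_of_div[OF q] rat_mod_spec(2)[OF assms q]
      localization_iff[OF prime_p q] assms by blast
qed

lemma rat_mod_of_int: "rat_mod p (of_int a) = a mod int p"
  using F.m_gt_one by (intro rat_mod_eqI[of 1 _ a]) auto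

lemma localization_add:
  assumes "c \<in> localization p" "d \<in> localization p"
  shows "c + d \<in> localization p" "rat_mod p (c + d) = rat_mod p c \<oplus>\<^bsub>R\<^esub> rat_mod p d"
proof -
  obtain a b where ab: "c = of_int a / of_int b" "\<not> int p dvd b" "[rat_mod p c * b = a] (mod int p)"
    using assms(1) by (rule localizationE)
  obtain a' b' where ab': "d = of_int a' / of_int b'" "\<not> int p dvd b'"
    "[rat_mod p d * b' = a'] (mod int p)"
    using assms(2) by (rule localizationE)
  have nz: "b \<noteq> 0" "b' \<noteq> 0" using ab ab' by auto
  have eq: "c + d = of_int (a * b' + a' * b) / of_int (b * b')"
    using nz by (simp add: ab ab' field_simps)
  have bb: "\<not> int p dvd b * b'" using ab ab' by (intro prime_not_dvd_mult)
  show "c + d \<in> localization p" using eq bb unfolding localization_def by blast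
  have "[(rat_mod p c * b) * b' + (rat_mod p d * b') * b = a * b' + a' * b] (mod int p)"
    using ab(3) ab'(3) by (intro cong_add cong_mult cong_refl)
  then have "[(rat_mod p c + rat_mod p d) * (b * b') = a * b' + a' * b] (mod int p)"
    by (simp add: algebra_simps)
  then have "[(rat_mod p c \<oplus>\<^bsub>R\<^esub> rat_mod p d) * (b * b') = a * b' + a' * b] (mod int p)"
    by (simp add: F.res_add_eq cong_def mod_simps)
  then show "rat_mod p (c + d) = rat_mod p c \<oplus>\<^bsub>R\<^esub> rat_mod p d"
    using eq bb assms by (intro rat_mod_eqI[of "b * b'" _ "a * b' + a' * b"])
      (auto intro: rat_mod_closed)
qed

lemma localization_mult:
  assumes "c \<in> localization p" "d \<in> localization p"
  shows "c * d \<in> localization p" "rat_mod p (c * d) = rat_mod p c \<otimes>\<^bsub>R\<^esub> rat_mod p d"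
proof -
  obtain a b where ab: "c = of_int a / of_int b" "\<not> int p dvd b" "[rat_mod p c * b = a] (mod int p)"
    using assms(1) by (rule localizationE)
  obtain a' b' where ab': "d = of_int a' / of_int b'" "\<not> int p dvd b'"
    "[rat_mod p d * b' = a'] (mod int p)"
    using assms(2) by (rule localizationE)
  have eq: "c * d = of_int (a * a') / of_int (b * b')"
    by (simp add: ab ab')
  have bb: "\<not> int p dvd b * b'" using ab ab' by (intro prime_not_dvd_mult)
  show "c * d \<in> localization p" using eq bb unfolding localization_def by blast
  have "[(rat_mod p c * b) * (rat_mod p d * b') = a * a'] (mod int p)"
    using ab(3) ab'(3) by (intro cong_mult)
  then have "[(rat_mod p c * rat_mod p d) * (b * b') = a * a'] (mod int p)"
    by (simp add: algebra_simps)
  then have "[(rat_mod p c \<otimes>\<^bsub>R\<^esub> rat_mod p d) * (b * b') = a * a'] (mod int p)"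
    by (simp add: F.res_mult_eq cong_def mod_simps)
  then show "rat_mod p (c * d) = rat_mod p c \<otimes>\<^bsub>R\<^esub> rat_mod p d"
    using eq bb assms by (intro rat_mod_eqI[of "b * b'" _ "a * a'"])
      (auto intro: rat_mod_closed)
qed

lemma localization_0: "0 \<in> localization p" "rat_mod p 0 = \<zero>\<^bsub>R\<^esub>"
proof -
  have "\<not> int p dvd 1" using F.m_gt_one by auto
  then show "0 \<in> localization p"
    unfolding localization_def by (intro CollectI exI[of _ 0] exI[of _ 1]) simp
  show "rat_mod p 0 = \<zero>\<^bsub>R\<^esub>"
    using rat_mod_of_int[of 0] by (simp add: F.res_zero_eq)
qed

lemma localization_sum:
  assumes "finite S" "\<And>i. i \<in> S \<Longrightarrow> c i \<in> localization p"
  shows "sum c S \<in> localization p \<and> rat_mod p (sum c S) = (\<Oplus>\<^bsub>R\<^esub>i\<in>S. rat_mod p (c i))"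
  using assms
proof (induction S rule: finite_induct)
  case empty
  then show ?case by (simp add: localization_0)
next
  case (insert x S)
  then show ?case
    by (auto simp: localization_add intro!: F.finsum_insert[symmetric] rat_mod_closed)
qed

section \<open>Reduction of polynomials and the exceptional primes\<close>

text \<open>Normalisation only strips leading zeros, and reversing the list reconciles the two
  opposite coefficient orders. Beyond the list both sides are zero.\<close>

lemma coeff_reduce_mod: "F.coeff (reduce_mod p f) i = rat_mod p (Polynomial.coeff f i)"
proof -
  let ?l = "map (rat_mod p) (rev (coeffs f))"
  have "F.coeff (reduce_mod p f) i = F.coeff ?l i"
    using F.normalize_coeff[of ?l] by (simp add: reduce_mod_def)
  also have "\<dots> = rat_mod p (Polynomial.coeff f i)"
  proof (cases "i < length (coeffs f)")
    case True
    then have "F.coeff ?l i = ?l ! (length ?l - 1 - i)" by (intro F.coeff_nth) simp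
    also have "\<dots> = rat_mod p (coeffs f ! i)"
      using True by (simp add: rev_nth)
    also have "coeffs f ! i = Polynomial.coeff f i"
      using True by (cases "f = 0") (auto simp: coeffs_nth length_coeffs_degree)
    finally show ?thesis .
  next
    case False
    then have "Polynomial.coeff f i = 0"
      by (cases "f = 0") (auto simp: length_coeffs coeff_eq_0)
    then show ?thesis
      using False F.coeff_length[of ?l i] by (simp add: localization_0)
  qed
  finally show ?thesis .
qed

lemma integral_primes_iff:
  "p \<in> integral_primes f \<longleftrightarrow> (\<forall>i. Polynomial.coeff f i \<in> localization p)"
  using prime_p by (simp add: integral_primes_def)

lemma reduce_mod_closed:
  assumes "p \<in> integral_primes f"
  shows "reduce_mod p f \<in> carrier P"
proof -
  have "c \<in> localization p" if "c \<in> set (coeffs f)" for c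
  proof -
    have "c \<in> range (Polynomial.coeff f)" using that by (simp add: range_coeff)
    then show ?thesis using assms by (auto simp: integral_primes_iff)
  qed
  then have "set (map (rat_mod p) (rev (coeffs f))) \<subseteq> carrier R"
    using rat_mod_closed by auto
  then show ?thesis
    unfolding reduce_mod_def carrier_polynomial by (rule F.normalize_gives_polynomial)
qed

lemma degree_reduce_mod: "Polynomials.degree (reduce_mod p f) \<le> Polynomial.degree f"
proof -
  have "length (reduce_mod p f) \<le> length (coeffs f)"
    using F.normalize_length_le[of "map (rat_mod p) (rev (coeffs f))"] by (simp add: reduce_mod_def)
  then show ?thesis by (cases "f = 0") (auto simp: length_coeffs)
qed

text \<open>Each coefficient of the product is a convolution sum, and \<open>rat_mod\<close>
  respects sums and products on the localization. Equal coefficients suffice because both lists are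
  normalised polynomials.\<close>

lemma integral_primes_mult:
  assumes "p \<in> integral_primes f" "p \<in> integral_primes g"
  shows "p \<in> integral_primes (f * g)" "reduce_mod p (f * g) = reduce_mod p f \<otimes> reduce_mod p g"
proof -
  have f: "Polynomial.coeff f i \<in> localization p" and g: "Polynomial.coeff g i \<in> localization p" for i
    using assms by (auto simp: integral_primes_iff)
  have sum: "(\<Sum>i\<le>n. Polynomial.coeff f i * Polynomial.coeff g (n - i)) \<in> localization p \<and>
     rat_mod p (\<Sum>i\<le>n. Polynomial.coeff f i * Polynomial.coeff g (n - i))
       = (\<Oplus>\<^bsub>R\<^esub>i\<in>{..n}. rat_mod p (Polynomial.coeff f i * Polynomial.coeff g (n - i)))" for n
    by (intro localization_sum localization_mult f g) simp
  then show fg: "p \<in> integral_primes (f * g)"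
    by (simp add: integral_primes_iff coeff_mult)
  have polys: "polynomial\<^bsub>R\<^esub> (carrier R) (reduce_mod p h)" if "p \<in> integral_primes h" for h
    using reduce_mod_closed[OF that] by (simp add: carrier_polynomial)
  have "F.coeff (reduce_mod p (f * g)) n = F.coeff (F.poly_mult (reduce_mod p f) (reduce_mod p g)) n" for n
    using F.polynomial_incl[OF polys[OF assms(1)]] F.polynomial_incl[OF polys[OF assms(2)]] sum[of n]
    by (simp add: F.poly_mult_coeff coeff_reduce_mod coeff_mult localization_mult f g)
  moreover have "polynomial\<^bsub>R\<^esub> (carrier R) (F.poly_mult (reduce_mod p f) (reduce_mod p g))"
    using polys assms by (intro F.poly_mult_closed F.carrier_is_subring)
  ultimately show "reduce_mod p (f * g) = reduce_mod p f \<otimes> reduce_mod p g"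
    using F.coeff_iff_polynomial_cond polys[OF fg] unfolding mult_eq by blast
qed

text \<open>If the reduction vanished, the leading coefficient would have residue 0, and the
  congruence defining this residue would make \<open>p\<close> divide its numerator.\<close>

lemma reduce_mod_neq_Nil:
  assumes "p \<in> integral_primes f"
    and "\<not> int p dvd fst (quotient_of (Polynomial.lead_coeff f))"
  shows "reduce_mod p f \<noteq> []"
proof
  assume "reduce_mod p f = []"
  then have 0: "rat_mod p (Polynomial.lead_coeff f) = 0"
    using coeff_reduce_mod[of f "Polynomial.degree f"] by (simp add: F.res_zero_eq)
  obtain a b where q: "quotient_of (Polynomial.lead_coeff f) = (a, b)"
    by (cases "quotient_of (Polynomial.lead_coeff f)") auto
  show False
    using rat_mod_spec(2)[OF _ q] assms q 0
    by (auto simp: integral_primes_iff cong_0_iff cong_sym_eq[of 0])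
qed

end

lemma finite_bad_primes:
  assumes "f \<noteq> 0"
  shows "finite {p. Factorial_Ring.prime p \<and> (p \<notin> integral_primes f \<or> reduce_mod p f = [])}"
proof -
  \<comment> \<open>A prime not dividing \<open>N\<close> divides no denominator, so
    \<open>f\<close> is integral there, and does not divide the leading numerator, so the reduction
    survives. The exceptional primes are thus among the divisors of a nonzero integer.\<close>
  define N where "N = fst (quotient_of (Polynomial.lead_coeff f)) * (\<Prod>c\<leftarrow>coeffs f. snd (quotient_of c))"
  have "snd (quotient_of c) \<noteq> 0" for c
    using quotient_of_denom_pos'[of c] by simp
  moreover have "fst (quotient_of (Polynomial.lead_coeff f)) \<noteq> 0"
  proof
    assume "fst (quotient_of (Polynomial.lead_coeff f)) = 0"
    then have "Polynomial.lead_coeff f = 0"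
      using quotient_of_div[of "Polynomial.lead_coeff f"]
      by (cases "quotient_of (Polynomial.lead_coeff f)") simp
    then show False using assms by simp
  qed
  ultimately have "N \<noteq> 0"
    by (auto simp: N_def prod_list_zero_iff)
  have "p \<in> integral_primes f \<and> reduce_mod p f \<noteq> []"
    if p: "Factorial_Ring.prime p" "\<not> int p dvd N" for p
  proof -
    interpret prime_poly_ring p "Fp_poly p" by unfold_locales (rule p(1))
    have "Polynomial.coeff f i \<in> localization p" for i
    proof (cases "Polynomial.coeff f i = 0")
      case False
      then have "Polynomial.coeff f i \<in> set (coeffs f)"
        using range_coeff[of f] by (metis insert_iff rangeI)
      then have "snd (quotient_of (Polynomial.coeff f i)) dvd (\<Prod>c\<leftarrow>coeffs f. snd (quotient_of c))"
        by (intro prod_list_dvd) auto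
      then have "\<not> int p dvd snd (quotient_of (Polynomial.coeff f i))"
        using p(2) unfolding N_def by (meson dvd_mult dvd_trans)
      then show ?thesis
        using localization_iff[OF p(1)] by (metis prod.collapse)
    qed (simp add: localization_0)
    then have "p \<in> integral_primes f" by (simp add: integral_primes_iff)
    moreover have "\<not> int p dvd fst (quotient_of (Polynomial.lead_coeff f))"
      using p(2) unfolding N_def by (meson dvd_mult2)
    ultimately show ?thesis using reduce_mod_neq_Nil by blast
  qed
  then have "{p. Factorial_Ring.prime p \<and> (p \<notin> integral_primes f \<or> reduce_mod p f = [])}
      \<subseteq> {p. int p dvd N}"
    by blast
  also have "\<dots> \<subseteq> {..nat \<bar>N\<bar>}"
    using \<open>N \<noteq> 0\<close> by (auto dest: dvd_imp_le_int)
  finally show ?thesis using finite_subset by blast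
qed

section \<open>Euler products\<close>

lemma convergent_prod_of_bounds:
  fixes f :: "nat \<Rightarrow> 'a \<Rightarrow> complex"
  assumes "summable M" "\<And>n. norm (f n w - 1) \<le> M n"
  shows "convergent_prod (\<lambda>n. f n w)"
proof -
  have "summable (\<lambda>n. norm (f n w - 1))"
    using assms by (intro summable_comparison_test'[OF assms(1), of 0]) auto
  then show ?thesis
    by (intro abs_convergent_prod_imp_convergent_prod summable_imp_abs_convergent_prod)
qed

text \<open>The local bounds make the partial products converge uniformly on a closed disc by the
  Weierstrass test, and locally uniform limits of holomorphic functions are holomorphic.\<close>

lemma holomorphic_on_prodinf:
  fixes f :: "nat \<Rightarrow> complex \<Rightarrow> complex"
  assumes "open S" and hol: "\<And>n. f n holomorphic_on S"
    and bound: "\<And>z. z \<in> S \<Longrightarrow> \<exists>d>0. cball z d \<subseteq> S \<and>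
       (\<exists>M. summable M \<and> (\<forall>n. \<forall>w\<in>cball z d. norm (f n w - 1) \<le> M n))"
  shows "(\<lambda>w. prodinf (\<lambda>n. f n w)) holomorphic_on S"
proof (rule holomorphic_uniform_sequence[OF \<open>open S\<close>])
  show "(\<lambda>w. \<Prod>n<N. f n w) holomorphic_on S" for N
    using hol by (intro holomorphic_intros)
  fix z assume "z \<in> S"
  from bound[OF this] obtain d M where d: "d > 0" "cball z d \<subseteq> S"
    and M: "summable M" "\<And>n w. w \<in> cball z d \<Longrightarrow> norm (f n w - 1) \<le> M n"
    by blast
  have "uniformly_convergent_on (cball z d) (\<lambda>N w. \<Prod>n<N. f n w)"
  proof (rule uniformly_convergent_on_prod')
    show "continuous_on (cball z d) (f n)" for n
      using hol d(2) by (meson holomorphic_on_imp_continuous_on holomorphic_on_subset)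
    show "uniformly_convergent_on (cball z d) (\<lambda>N w. \<Sum>n<N. norm (f n w - 1))"
      using M by (intro Weierstrass_m_test'[of _ _ M]) auto
  qed simp
  then obtain g where g: "uniform_limit (cball z d) (\<lambda>N w. \<Prod>n<N. f n w) g sequentially"
    by (auto simp: uniformly_convergent_on_def)
  have "g w = prodinf (\<lambda>n. f n w)" if w: "w \<in> cball z d" for w
  proof -
    \<comment> \<open>The index is shifted because \<open>convergent_prod_LIMSEQ\<close> speaks of
      products over \<open>{..N}\<close>, while the uniform limit uses
      \<open>{..<N}\<close>.\<close>
    have "(\<lambda>N. \<Prod>n<Suc N. f n w) \<longlonglongrightarrow> g w"
      using tendsto_uniform_limitI[OF g w] by (rule LIMSEQ_Suc)
    moreover have "(\<lambda>N. \<Prod>n<Suc N. f n w) \<longlonglongrightarrow> prodinf (\<lambda>n. f n w)"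
      unfolding lessThan_Suc_atMost
      using convergent_prod_of_bounds[of M f w, OF M(1) M(2)[OF w]] by (rule convergent_prod_LIMSEQ)
    ultimately show ?thesis by (rule LIMSEQ_unique)
  qed
  then have "uniform_limit (cball z d) (\<lambda>N w. \<Prod>n<N. f n w) (\<lambda>w. prodinf (\<lambda>n. f n w)) sequentially"
    using g by (subst uniform_limit_cong'[where g = "\<lambda>N w. \<Prod>n<N. f n w" and i = g]) auto
  then show "\<exists>d>0. cball z d \<subseteq> S \<and>
      uniform_limit (cball z d) (\<lambda>N w. \<Prod>n<N. f n w) (\<lambda>w. prodinf (\<lambda>n. f n w)) sequentially"
    using d by blast
qed

section \<open>Bounds for the local factors\<close>

text \<open>Expand \<open>a * b - 1\<close> as \<open>(a - 1) * (b - 1) + (a - 1) + (b - 1)\<close>.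
  Writing the bounds as \<open>A - 1\<close> makes them multiplicative, so they extend to powers and
  finite products.\<close>

lemma norm_mult_minus1_le:
  fixes a b :: complex
  assumes "norm (a - 1) \<le> A - 1" "norm (b - 1) \<le> B - 1"
  shows "norm (a * b - 1) \<le> A * B - 1"
proof -
  have "a * b - 1 = (a - 1) * (b - 1) + (a - 1) + (b - 1)" by (simp add: algebra_simps)
  then have "norm (a * b - 1) \<le> norm ((a - 1) * (b - 1)) + norm (a - 1) + norm (b - 1)"
    by (metis norm_triangle_le norm_triangle_mono order_refl)
  also have "norm ((a - 1) * (b - 1)) \<le> (A - 1) * (B - 1)"
    unfolding norm_mult using assms order_trans[OF norm_ge_zero assms(1)]
    by (intro mult_mono) auto
  finally show ?thesis using assms by (simp add: algebra_simps)
qed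

lemma norm_power_minus1_le:
  fixes a :: complex
  assumes "norm (a - 1) \<le> A - 1"
  shows "norm (a ^ n - 1) \<le> A ^ n - 1"
  by (induction n) (auto intro: norm_mult_minus1_le assms)

lemma norm_prod_power_minus1_le:
  fixes a :: "'a \<Rightarrow> complex"
  assumes "\<And>i. i \<in> I \<Longrightarrow> norm (a i - 1) \<le> A - 1"
  shows "norm ((\<Prod>i\<in>I. a i ^ n i) - 1) \<le> A ^ (\<Sum>i\<in>I. n i) - 1"
  using assms
  by (induction I rule: infinite_finite_induct)
     (auto simp: power_add intro!: norm_mult_minus1_le norm_power_minus1_le)

text \<open>Passing from \<open>n\<close> to \<open>n + 1\<close> adds
  \<open>y * (1 + y) ^ n\<close>, which is at most \<open>2 ^ n * y\<close>. A bound linear in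
  \<open>y\<close> is needed for summability over the primes.\<close>

lemma power_one_plus_le:
  fixes y :: real
  assumes "0 \<le> y" "y \<le> 1"
  shows "(1 + y) ^ n - 1 \<le> 2 ^ n * y"
proof (induction n)
  case (Suc n)
  have "(1 + y) ^ n \<le> 2 ^ n" using assms by (intro power_mono) auto
  then have "y * (1 + y) ^ n \<le> y * 2 ^ n" using assms(1) by (rule mult_left_mono)
  then show ?case using Suc by (simp add: algebra_simps)
qed (use assms in auto)

lemma norm_inverse_one_minus_le:
  fixes z :: complex
  assumes "norm z \<le> 1 / 2"
  shows "norm (inverse (1 - z) - 1) \<le> 2 * norm z"
proof -
  have ge: "norm (1 - z) \<ge> 1 / 2"
    using norm_triangle_ineq2[of 1 z] assms by simp
  then have nz: "1 - z \<noteq> 0" by auto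
  then have "inverse (1 - z) - 1 = z / (1 - z)" by (simp add: field_simps)
  then have "norm (inverse (1 - z) - 1) = norm z / norm (1 - z)" by (simp add: norm_divide)
  also have "\<dots> \<le> norm z / (1 / 2)" using ge by (intro divide_left_mono) auto
  finally show ?thesis by simp
qed

text \<open>The logarithm of a positive integer is real, so no branch problem arises. This rewrites
  local factors in terms of the generators with base \<open>p ^ d\<close>.\<close>

lemma powr_of_nat_power:
  assumes "p > 0"
  shows "of_nat p powr (- (of_nat d * s)) = (of_nat (p ^ d) powr (- s) :: complex)"
proof -
  have "Ln (of_nat (p ^ d) :: complex) = of_nat d * Ln (of_nat p)"
    using assms by (simp only: Ln_of_nat zero_less_power) (simp add: ln_realpow)
  then show ?thesis using assms by (simp add: powr_def mult_ac)
qed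

definition zeta_factor :: "rat poly \<Rightarrow> nat \<Rightarrow> complex \<Rightarrow> complex" where
  "zeta_factor f p s = (if p \<in> integral_primes f then local_zeta f p s else 1)"

text \<open>The exponent function enters through an equation so that a sum of two exponent functions
  can be substituted in \<open>zeta_factor_mult\<close>.\<close>

lemma local_zeta_eq:
  assumes "\<alpha> = exponents p (reduce_mod p f)"
  shows "local_zeta f p s = (\<Prod>g | \<alpha> g \<noteq> 0.
    inverse (1 - of_nat p powr (- (of_nat (Polynomials.degree g) * s))) ^ \<alpha> g)"
  unfolding local_zeta_def Let_def assms
  by (intro prod.cong refl) (simp add: power_int_minus power_inverse)

text \<open>A single local factor is a finite product of inverses of generators and so lies in the
  Euler subgroup. Hence changing finitely many factors does not affect the class.\<close>

lemma euler_function_zeta_factor: "euler_function (zeta_factor f p)"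
proof (cases "p \<in> integral_primes f")
  case False
  then show ?thesis using euler_function_one by (simp add: zeta_factor_def[abs_def])
next
  case True
  then have p: "Factorial_Ring.prime p" by (simp add: integral_primes_def)
  interpret prime_poly_ring p "Fp_poly p" by unfold_locales (rule p)
  define \<alpha> where "\<alpha> = exponents p (reduce_mod p f)"
  note \<alpha> = exponents_bounds[OF reduce_mod_closed[OF True], folded \<alpha>_def]
  have "euler_function (\<lambda>s. \<Prod>g | \<alpha> g \<noteq> 0.
    inverse (1 - of_nat p powr (- (of_nat (Polynomials.degree g) * s))) ^ \<alpha> g)"
  proof (intro euler_function_prod euler_function_power euler_function_inverse)
    fix g assume "g \<in> {g. \<alpha> g \<noteq> 0}"
    then have "Polynomials.degree g \<ge> 1" using \<alpha>(2) by (intro degree_monic_irreducible) auto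
    then have "p ^ 1 \<le> p ^ Polynomials.degree g"
      using prime_gt_0_nat[OF p] by (intro power_increasing) auto
    then have "p ^ Polynomials.degree g \<ge> 2" using prime_ge_2_nat[OF p] by simp
    from euler_function_generator[OF this]
    show "euler_function (\<lambda>s. 1 - of_nat p powr (- (of_nat (Polynomials.degree g) * s)))"
      by (simp only: powr_of_nat_power[OF prime_gt_0_nat[OF p]])
  qed
  moreover have "zeta_factor f p = (\<lambda>s. \<Prod>g | \<alpha> g \<noteq> 0.
    inverse (1 - of_nat p powr (- (of_nat (Polynomials.degree g) * s))) ^ \<alpha> g)"
    using True local_zeta_eq[OF \<alpha>_def] by (auto simp: zeta_factor_def fun_eq_iff)
  ultimately show ?thesis by simp
qed

text \<open>Every irreducible factor has degree at least 1, so each term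
  \<open>p powr (- d * s)\<close> has norm at most \<open>p powr (- \<sigma>)\<close>. Counted with
  multiplicity, there are at most as many factors as the degree of \<open>f\<close>, independently
  of \<open>p\<close>.\<close>

lemma norm_zeta_factor_minus1_le:
  assumes "\<sigma> \<ge> 1" "Re s \<ge> \<sigma>"
  shows "norm (zeta_factor f p s - 1) \<le> 2 ^ Polynomial.degree f * (2 * real p powr (- \<sigma>))"
proof (cases "p \<in> integral_primes f")
  case False
  then show ?thesis by (simp add: zeta_factor_def)
next
  case True
  then have p: "Factorial_Ring.prime p" by (simp add: integral_primes_def)
  then have p2: "p \<ge> 2" by (rule prime_ge_2_nat)
  interpret prime_poly_ring p "Fp_poly p" by unfold_locales (rule p)
  define \<alpha> where "\<alpha> = exponents p (reduce_mod p f)"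
  note \<alpha> = exponents_bounds[OF reduce_mod_closed[OF True], folded \<alpha>_def]
  \<comment> \<open>The factor 2 comes from \<open>norm_inverse_one_minus_le\<close>; since
    \<open>p\<close> is at least 2, also \<open>y\<close> is at most 1, as
    \<open>power_one_plus_le\<close> requires.\<close>
  define y where "y = 2 * real p powr (- \<sigma>)"
  have "real p powr (- \<sigma>) \<le> real p powr (- 1)"
    using assms p2 by (intro powr_mono) auto
  also have "\<dots> \<le> 1 / 2" using p2 by (simp add: powr_minus field_simps)
  finally have half: "real p powr (- \<sigma>) \<le> 1 / 2" .
  then have y: "0 \<le> y" "y \<le> 1" by (auto simp: y_def)
  have "norm (inverse (1 - of_nat p powr (- (of_nat (Polynomials.degree g) * s))) - 1) \<le> (1 + y) - 1"
    if "g \<in> {g. \<alpha> g \<noteq> 0}" for g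
  proof -
    have d: "Polynomials.degree g \<ge> 1" using \<alpha>(2) that by (intro degree_monic_irreducible) auto
    let ?z = "of_nat p powr (- (of_nat (Polynomials.degree g) * s)) :: complex"
    have "1 * \<sigma> \<le> real (Polynomials.degree g) * Re s"
      using assms d by (intro mult_mono) auto
    then have "real p powr (- (real (Polynomials.degree g) * Re s)) \<le> real p powr (- \<sigma>)"
      using p2 by (intro powr_mono) auto
    moreover have "norm ?z = real p powr (- (real (Polynomials.degree g) * Re s))"
      using p2 by (simp add: norm_powr_real_powr)
    ultimately have "norm ?z \<le> real p powr (- \<sigma>)" by simp
    then show ?thesis
      using norm_inverse_one_minus_le[of ?z] half by (simp add: y_def)
  qed
  then have "norm (zeta_factor f p s - 1) \<le> (1 + y) ^ (\<Sum>g | \<alpha> g \<noteq> 0. \<alpha> g) - 1"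
    using True by (simp only: zeta_factor_def if_True local_zeta_eq[OF \<alpha>_def])
      (rule norm_prod_power_minus1_le)
  also have "\<dots> \<le> (1 + y) ^ Polynomial.degree f - 1"
    using y \<alpha>(3) degree_reduce_mod[of f] by (intro diff_right_mono power_increasing) auto
  also have "\<dots> \<le> 2 ^ Polynomial.degree f * y"
    by (rule power_one_plus_le[OF y])
  finally show ?thesis by (simp add: y_def)
qed

lemma summable_zeta_bound:
  assumes "\<sigma> > 1"
  shows "summable (\<lambda>p. 2 ^ N * (2 * real p powr (- \<sigma>)))"
  using assms by (intro summable_mult) (simp add: summable_real_powr_iff)

lemma convergent_prod_zeta_factor:
  assumes "s \<in> halfplane"
  shows "convergent_prod (\<lambda>p. zeta_factor f p s)"
  using assms by (intro convergent_prod_of_bounds[OF summable_zeta_bound norm_zeta_factor_minus1_le])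
    (auto simp: halfplane_def)

section \<open>The global zeta function and its behaviour under products\<close>

definition zeta_fun :: "rat poly \<Rightarrow> complex \<Rightarrow> complex" where
  "zeta_fun f s = prodinf (\<lambda>p. zeta_factor f p s)"

lemma global_zeta_eq: "global_zeta f = restrict (zeta_fun f) halfplane"
  unfolding global_zeta_def zeta_fun_def zeta_factor_def by (rule refl)

lemma zeta_factor_nonvanishing: "nonvanishing (zeta_factor f p)"
  using euler_function_zeta_factor by (simp add: euler_function_def)

lemma nonvanishing_zeta_fun: "nonvanishing (zeta_fun f)"
proof -
  have "(\<lambda>s. prodinf (\<lambda>p. zeta_factor f p s)) holomorphic_on halfplane"
  proof (rule holomorphic_on_prodinf[OF open_halfplane])
    show "zeta_factor f p holomorphic_on halfplane" for p
      using zeta_factor_nonvanishing by (simp add: nonvanishing_def)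
    fix z assume z: "z \<in> halfplane"
    \<comment> \<open>The disc reaches half way to the line where the real part is 1, so real parts
      on it stay above the midpoint \<sigma> of 1 and \<open>Re z\<close>, which gives one summable
      majorant.\<close>
    define d where "d = (Re z - 1) / 2"
    define \<sigma> where "\<sigma> = (Re z + 1) / 2"
    have d0: "d > 0" "\<sigma> > 1" using z by (auto simp: d_def \<sigma>_def halfplane_def)
    have Re: "Re w \<ge> \<sigma>" if "w \<in> cball z d" for w
      using abs_Re_le_cmod[of "z - w"] that
      by (simp add: dist_norm d_def \<sigma>_def field_simps)
    then have "cball z d \<subseteq> halfplane" using d0 by (force simp: halfplane_def)
    moreover have "norm (zeta_factor f p w - 1) \<le> 2 ^ Polynomial.degree f * (2 * real p powr (- \<sigma>))"
      if "w \<in> cball z d" for p w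
      using d0 Re[OF that] by (intro norm_zeta_factor_minus1_le) auto
    ultimately show "\<exists>d>0. cball z d \<subseteq> halfplane \<and>
       (\<exists>M. summable M \<and> (\<forall>p. \<forall>w\<in>cball z d. norm (zeta_factor f p w - 1) \<le> M p))"
      using d0 summable_zeta_bound[OF d0(2)] by blast
  qed
  moreover have "prodinf (\<lambda>p. zeta_factor f p s) \<noteq> 0" if "s \<in> halfplane" for s
    using zeta_factor_nonvanishing that
    by (intro prodinf_nonzero convergent_prod_zeta_factor) (auto simp: nonvanishing_def)
  ultimately show ?thesis by (simp add: nonvanishing_def zeta_fun_def[abs_def])
qed

text \<open>The reduction has degree 0, so the bound on the total exponent leaves no irreducible
  factor and the local product is empty.\<close>

lemma zeta_factor_const: "zeta_factor [:q:] p s = 1"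
proof (cases "p \<in> integral_primes [:q:]")
  case True
  then have p: "Factorial_Ring.prime p" by (simp add: integral_primes_def)
  interpret prime_poly_ring p "Fp_poly p" by unfold_locales (rule p)
  define \<alpha> where "\<alpha> = exponents p (reduce_mod p [:q:])"
  note \<alpha> = exponents_bounds[OF reduce_mod_closed[OF True], folded \<alpha>_def]
  have "(\<Sum>g | \<alpha> g \<noteq> 0. \<alpha> g) = 0"
    using \<alpha>(3) degree_reduce_mod[of "[:q:]"] by simp
  then have "{g. \<alpha> g \<noteq> 0} = {}" using \<alpha>(1) by simp
  then show ?thesis
    using True local_zeta_eq[OF \<alpha>_def, of s] by (simp add: zeta_factor_def)
qed (simp add: zeta_factor_def)

lemma zeta_factor_mult:
  assumes "Factorial_Ring.prime p"
    and f: "p \<in> integral_primes f" "reduce_mod p f \<noteq> []"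
    and g: "p \<in> integral_primes g" "reduce_mod p g \<noteq> []"
  shows "zeta_factor (f * g) p s = zeta_factor f p s * zeta_factor g p s"
proof -
  interpret prime_poly_ring p "Fp_poly p" by unfold_locales (rule assms(1))
  define \<alpha> where "\<alpha> = exponents p (reduce_mod p f)"
  define \<beta> where "\<beta> = exponents p (reduce_mod p g)"
  note \<alpha> = exponents_bounds[OF reduce_mod_closed[OF f(1)], folded \<alpha>_def]
  note \<beta> = exponents_bounds[OF reduce_mod_closed[OF g(1)], folded \<beta>_def]
  note fg = integral_primes_mult[OF f(1) g(1)]
  have \<gamma>: "(\<lambda>x. \<alpha> x + \<beta> x) = exponents p (reduce_mod p (f * g))"
    using exponents_mult[OF reduce_mod_closed[OF f(1)] reduce_mod_closed[OF g(1)] f(2) g(2)]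
    by (simp add: fg \<alpha>_def \<beta>_def)
  define c where "c x = inverse (1 - of_nat p powr (- (of_nat (Polynomials.degree x) * s)))"
    for x :: "int list"
  let ?S = "{x. \<alpha> x \<noteq> 0} \<union> {x. \<beta> x \<noteq> 0}"
  have fin: "finite ?S" using \<alpha>(1) \<beta>(1) by simp
  have "local_zeta (f * g) p s = (\<Prod>x | \<alpha> x + \<beta> x \<noteq> 0. c x ^ (\<alpha> x + \<beta> x))"
    unfolding c_def by (rule local_zeta_eq[OF \<gamma>])
  also have "{x. \<alpha> x + \<beta> x \<noteq> 0} = ?S" by auto
  also have "(\<Prod>x\<in>?S. c x ^ (\<alpha> x + \<beta> x)) = (\<Prod>x\<in>?S. c x ^ \<alpha> x) * (\<Prod>x\<in>?S. c x ^ \<beta> x)"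
    by (simp add: power_add prod.distrib)
  also have "(\<Prod>x\<in>?S. c x ^ \<alpha> x) = (\<Prod>x | \<alpha> x \<noteq> 0. c x ^ \<alpha> x)"
    using fin by (intro prod.mono_neutral_right) auto
  also have "(\<Prod>x\<in>?S. c x ^ \<beta> x) = (\<Prod>x | \<beta> x \<noteq> 0. c x ^ \<beta> x)"
    using fin by (intro prod.mono_neutral_right) auto
  also have "(\<Prod>x | \<alpha> x \<noteq> 0. c x ^ \<alpha> x) = local_zeta f p s"
    unfolding c_def by (rule local_zeta_eq[OF \<alpha>_def, symmetric])
  also have "(\<Prod>x | \<beta> x \<noteq> 0. c x ^ \<beta> x) = local_zeta g p s"
    unfolding c_def by (rule local_zeta_eq[OF \<beta>_def, symmetric])
  finally show ?thesis using f(1) g(1) fg(1) by (simp add: zeta_factor_def)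
qed

text \<open>Exceptional primes can really contribute: for \<open>X / p\<close> and
  \<open>p * X\<close> both factors at \<open>p\<close> are 1, by non-integrality and by vanishing
  reduction, while the product \<open>X ^ 2\<close> has a nontrivial factor there.\<close>

lemma zeta_fun_mult:
  assumes "f \<noteq> 0" "g \<noteq> 0"
  shows "\<exists>e. euler_function e \<and>
    (\<forall>s\<in>halfplane. zeta_fun (f * g) s = e s * (zeta_fun f s * zeta_fun g s))"
proof -
  define B where "B = {p. Factorial_Ring.prime p \<and> (p \<notin> integral_primes f \<or> reduce_mod p f = [])}
    \<union> {p. Factorial_Ring.prime p \<and> (p \<notin> integral_primes g \<or> reduce_mod p g = [])}"
  have finB: "finite B" using finite_bad_primes assms by (simp add: B_def)
  \<comment> \<open>This quotient measures the failure of multiplicativity at \<open>p\<close>. Only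
    its values for \<open>p\<close> in the finite set \<open>B\<close> are used, which keeps the
    correction \<open>e\<close> a finite product of Euler functions.\<close>
  define c where "c p s = zeta_factor (f * g) p s * inverse (zeta_factor f p s * zeta_factor g p s)"
    for p s
  have c: "zeta_factor (f * g) p s = (if p \<in> B then c p s else 1) * (zeta_factor f p s * zeta_factor g p s)"
    if "s \<in> halfplane" for p s
  proof (cases "p \<in> B")
    case True
    have "zeta_factor f p s \<noteq> 0" "zeta_factor g p s \<noteq> 0"
      using zeta_factor_nonvanishing that by (auto simp: nonvanishing_def)
    then show ?thesis using True by (simp add: c_def field_simps)
  next
    case False
    show ?thesis
    proof (cases "Factorial_Ring.prime p")
      case True
      then have "p \<in> integral_primes f \<and> reduce_mod p f \<noteq> [] \<and> p \<in> integral_primes g \<and> reduce_mod p g \<noteq> []"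
        using \<open>p \<notin> B\<close> unfolding B_def by blast
      then show ?thesis using False zeta_factor_mult[OF True] by simp
    qed (use False in \<open>simp add: zeta_factor_def integral_primes_def\<close>)
  qed
  define e where "e = (\<lambda>s. \<Prod>p\<in>B. c p s)"
  have "euler_function e"
    unfolding e_def c_def
    by (intro euler_function_prod euler_function_mult euler_function_inverse euler_function_zeta_factor)
  moreover have "zeta_fun (f * g) s = e s * (zeta_fun f s * zeta_fun g s)" if s: "s \<in> halfplane" for s
  proof -
    have conv: "convergent_prod (\<lambda>p. if p \<in> B then c p s else 1)"
      using finB by (rule convergent_prod_If_finite_set)
    have conv': "convergent_prod (\<lambda>p. zeta_factor f p s * zeta_factor g p s)"
      using s by (intro convergent_prod_mult convergent_prod_zeta_factor)
    have "zeta_fun (f * g) s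
        = prodinf (\<lambda>p. (if p \<in> B then c p s else 1) * (zeta_factor f p s * zeta_factor g p s))"
      unfolding zeta_fun_def by (intro prodinf_cong c s)
    also have "\<dots> = prodinf (\<lambda>p. if p \<in> B then c p s else 1)
        * prodinf (\<lambda>p. zeta_factor f p s * zeta_factor g p s)"
      by (rule prodinf_mult[OF conv conv', symmetric])
    also have "prodinf (\<lambda>p. if p \<in> B then c p s else 1) = (\<Prod>p\<in>B. if p \<in> B then c p s else 1)"
      using finB by (rule prodinf_finite) simp
    also have "\<dots> = e s" by (simp add: e_def)
    also have "prodinf (\<lambda>p. zeta_factor f p s * zeta_factor g p s) = zeta_fun f s * zeta_fun g s"
      unfolding zeta_fun_def using s by (intro prodinf_mult[symmetric] convergent_prod_zeta_factor)
    finally show ?thesis .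
  qed
  ultimately show ?thesis by blast
qed

section \<open>Zeta classes in the quotient group\<close>

interpretation euler: normal euler_subgroup mero_group
  using subgroup_euler by (simp add: mero.normal_iff_subgroup)

abbreviation zeta_class_group where
  "zeta_class_group \<equiv> mero_group Mod euler_subgroup"

interpretation zq: comm_group zeta_class_group
  by (rule mero.abelian_FactGroup[OF subgroup_euler])

lemma global_zeta_closed: "global_zeta f \<in> carrier mero_group"
  unfolding global_zeta_eq by (intro nonvanishing_in_mero_group nonvanishing_zeta_fun)

text \<open>The quotient group is built from right cosets, whereas the class is a left coset; the
  two agree because the subgroup is normal.\<close>

lemma zeta_class_rcos: "zeta_class f = euler_subgroup #>\<^bsub>mero_group\<^esub> global_zeta f"
  unfolding zeta_class_def using euler.coset_eq global_zeta_closed by auto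

lemma zeta_class_closed: "zeta_class f \<in> carrier zeta_class_group"
  unfolding zeta_class_rcos carrier_FactGroup using global_zeta_closed by (rule imageI)

lemma zeta_class_const: "zeta_class [:q:] = \<one>\<^bsub>zeta_class_group\<^esub>"
proof -
  have "global_zeta [:q:] = \<one>\<^bsub>mero_group\<^esub>"
    by (simp add: global_zeta_eq zeta_fun_def[abs_def] zeta_factor_const one_mero_group)
  then show ?thesis
    using mero.coset_mult_one[OF euler.subset] by (simp add: zeta_class_rcos)
qed

text \<open>The correction \<open>e\<close> from \<open>zeta_fun_mult\<close> lies in the subgroup
  and is absorbed by the coset.\<close>

lemma zeta_class_mult:
  assumes "f \<noteq> 0" "g \<noteq> 0"
  shows "zeta_class (f * g) = zeta_class f \<otimes>\<^bsub>zeta_class_group\<^esub> zeta_class g"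
proof -
  obtain e where e: "euler_function e"
    "\<And>s. s \<in> halfplane \<Longrightarrow> zeta_fun (f * g) s = e s * (zeta_fun f s * zeta_fun g s)"
    using zeta_fun_mult[OF assms] by blast
  let ?e = "restrict e halfplane"
  have eE: "?e \<in> euler_subgroup" and ne: "nonvanishing e"
    using e(1) by (auto simp: euler_function_def)
  have "global_zeta (f * g) = restrict (\<lambda>s. e s * (zeta_fun f s * zeta_fun g s)) halfplane"
    unfolding global_zeta_eq using e(2) by (intro restrict_ext)
  also have "\<dots> = ?e \<otimes>\<^bsub>mero_group\<^esub> (global_zeta f \<otimes>\<^bsub>mero_group\<^esub> global_zeta g)"
    by (simp add: global_zeta_eq mult_mero_group_nonvanishing nonvanishing_mult nonvanishing_zeta_fun ne)
  finally have "zeta_class (f * g)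
      = (euler_subgroup #>\<^bsub>mero_group\<^esub> ?e) #>\<^bsub>mero_group\<^esub> (global_zeta f \<otimes>\<^bsub>mero_group\<^esub> global_zeta g)"
    using eE euler.subset global_zeta_closed
    by (simp add: zeta_class_rcos mero.coset_mult_assoc subset_iff)
  also have "euler_subgroup #>\<^bsub>mero_group\<^esub> ?e = euler_subgroup"
    using eE euler.subset by (intro mero.coset_join2 subgroup_euler) auto
  finally show ?thesis
    by (simp add: zeta_class_rcos euler.rcos_sum global_zeta_closed)
qed

lemma zeta_class_power:
  assumes "f \<noteq> 0"
  shows "zeta_class (f ^ n) = zeta_class f [^]\<^bsub>zeta_class_group\<^esub> n"
proof (induction n)
  case 0
  then show ?case using zeta_class_const[of 1] by (simp add: one_pCons)
next
  case (Suc n)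
  have "zeta_class (f ^ Suc n) = zeta_class (f ^ n) \<otimes>\<^bsub>zeta_class_group\<^esub> zeta_class f"
    using assms zeta_class_mult[of "f ^ n" f] by (simp add: mult.commute)
  then show ?case using Suc by simp
qed

lemma zeta_class_prod:
  assumes "finite I" "\<And>i. i \<in> I \<Longrightarrow> f i \<noteq> 0"
  shows "zeta_class (\<Prod>i\<in>I. f i) = (\<Otimes>\<^bsub>zeta_class_group\<^esub>i\<in>I. zeta_class (f i))"
  using assms
proof (induction I rule: finite_induct)
  case empty
  then show ?case using zeta_class_const[of 1] by (simp add: one_pCons)
next
  case (insert x I)
  have "zeta_class (\<Prod>i\<in>insert x I. f i)
      = zeta_class (f x) \<otimes>\<^bsub>zeta_class_group\<^esub> zeta_class (\<Prod>i\<in>I. f i)"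
    using insert by (simp add: zeta_class_mult)
  also have "\<dots> = (\<Otimes>\<^bsub>zeta_class_group\<^esub>i\<in>insert x I. zeta_class (f i))"
    using insert zeta_class_closed by (subst zq.finprod_insert) auto
  finally show ?case .
qed

theorem theorem4p1:
  fixes f :: "rat poly" and q :: rat and m :: nat
    and F :: "nat \<Rightarrow> rat poly" and \<beta> :: "nat \<Rightarrow> nat"
  assumes "q \<noteq> 0"
    and "\<And>i. i \<in> {1..m} \<Longrightarrow> \<beta> i > 0"
    and "\<And>i. i \<in> {1..m} \<Longrightarrow> Factorial_Ring.irreducible (F i)"
    and "\<And>i. i \<in> {1..m} \<Longrightarrow> Polynomial.lead_coeff (F i) = 1"
    and "inj_on F {1..m}"
    and "f = Polynomial.smult q (\<Prod>i\<in>{1..m}. F i ^ \<beta> i)"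
  shows "zeta_class f =
    (\<Otimes>\<^bsub>mero_group Mod euler_subgroup\<^esub>i\<in>{1..m}.
       zeta_class (F i) [^]\<^bsub>mero_group Mod euler_subgroup\<^esub> \<beta> i)"
proof -
  let ?g = "\<Prod>i\<in>{1..m}. F i ^ \<beta> i"
  have nz: "F i \<noteq> 0" if "i \<in> {1..m}" for i
    using assms(4)[OF that] by auto
  \<comment> \<open>The scalar is treated as the constant polynomial \<open>[:q:]\<close>, whose
    class is trivial.\<close>
  then have "zeta_class f = zeta_class [:q:] \<otimes>\<^bsub>zeta_class_group\<^esub> zeta_class ?g"
    using zeta_class_mult[of "[:q:]" ?g] assms(1,6) by simp
  also have "\<dots> = zeta_class ?g"
    \<comment> \<open>The deleted rules would unfold the quotient operations into cosets and hide
      the unit law.\<close>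
    by (simp add: zeta_class_const zeta_class_closed del: one_FactGroup mult_FactGroup)
  also have "\<dots> = (\<Otimes>\<^bsub>zeta_class_group\<^esub>i\<in>{1..m}. zeta_class (F i ^ \<beta> i))"
    using nz by (intro zeta_class_prod) auto
  also have "\<dots> = (\<Otimes>\<^bsub>zeta_class_group\<^esub>i\<in>{1..m}. zeta_class (F i) [^]\<^bsub>zeta_class_group\<^esub> \<beta> i)"
    using nz zeta_class_closed by (intro zq.finprod_cong') (auto simp: zeta_class_power)
  finally show ?thesis .
qed

end
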